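(* Let $S_n=(E_{n-4},K_4)$ be a split graph on $n$ vertices (whose maximal clique has size $4$). Then $S_n$ is word-representable if and only if $S_n$ contains none of the graphs $T_1$, $T_2$, $T_3$, $T_4$ as an induced subgraph.
   Context: All graphs are finite and simple. Two distinct letters $x,y$ alternate in a word $w$ if deleting all letters of $w$ other than the copies of $x$ and $y$ leaves a word $xyxy\cdots$ or $yxyx\cdots$ (of even or odd length). A graph $G=(V,E)$ is word-representable if there is a word $w$ over the alphabet $V$, containing each letter of $V$, such that for all distinct $x,y\in V$, $x$ and $y$ alternate in $w$ if and only if $xy\in E$. Split graph convention: $S_n=(E_{n-m},K_m)$ denotes a graph on $n$ vertices whose vertex set is partitioned into a clique $K_m$ on $m$ vertices and an independent set $E_{n-m}$ on $n-m$ vertices, where the clique $K_m$ is maximal, i.e. every vertex of $E_{n-m}$ has degree at most $m-1$. Each of the following graphs consists of a clique on $\{1,2,3,4\}$ together with additional pairwise non-adjacent vertices whose neighbourhoods are as listed: $T_1$ (7 vertices): three additional vertices with neighbourhoods $\{1,2\}$, $\{2,3\}$, $\{1,3\}$. $T_2$ (7 vertices): three additional vertices with neighbourhoods $\{1,2\}$, $\{2,3\}$, $\{2,4\}$. $T_3$ (7 vertices): three additional vertices with neighbourhoods $\{1,2,3\}$, $\{1,2,4\}$, $\{2,3,4\}$. $T_4$ (8 vertices): four additional vertices with neighbourhoods $\{1,2\}$, $\{1,4\}$, $\{1,2,3\}$, $\{1,3,4\}$. *)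

theory Defs
  imports "Graph_Theory.Graph_Theory"
begin

text \<open>
  A finite simple graph is a \<^locale>\<open>pair_graph\<close>: a finite loop-free symmetric digraph without
  parallel arcs, in which an undirected edge xy is represented by the two arcs (x, y) and (y, x).
\<close>

definition alternating_word :: "'a \<Rightarrow> 'a \<Rightarrow> nat \<Rightarrow> 'a list" where
  "alternating_word x y l = map (\<lambda>i. if even i then x else y) [0..<l]"

definition alternate :: "'a list \<Rightarrow> 'a \<Rightarrow> 'a \<Rightarrow> bool" where
  "alternate w x y \<longleftrightarrow>
     (\<exists>l. filter (\<lambda>z. z \<in> {x, y}) w = alternating_word x y l \<or>
          filter (\<lambda>z. z \<in> {x, y}) w = alternating_word y x l)"

definition word_representable :: "'a pair_pre_digraph \<Rightarrow> bool" where
  "word_representable G \<longleftrightarrow>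
     (\<exists>w. set w = pverts G \<and>
          (\<forall>x \<in> pverts G. \<forall>y \<in> pverts G. x \<noteq> y \<longrightarrow> (alternate w x y \<longleftrightarrow> (x, y) \<in> parcs G)))"

definition is_clique :: "'a pair_pre_digraph \<Rightarrow> 'a set \<Rightarrow> bool" where
  "is_clique G K \<longleftrightarrow>
     K \<subseteq> pverts G \<and> (\<forall>x \<in> K. \<forall>y \<in> K. x \<noteq> y \<longrightarrow> (x, y) \<in> parcs G)"

definition is_independent :: "'a pair_pre_digraph \<Rightarrow> 'a set \<Rightarrow> bool" where
  "is_independent G I \<longleftrightarrow>
     I \<subseteq> pverts G \<and> (\<forall>x \<in> I. \<forall>y \<in> I. (x, y) \<notin> parcs G)"

text \<open>
  \<open>split_graph n m G\<close> says that \<open>G\<close> is a graph of the form \<open>S\<^sub>n = (E\<^sub>n\<^sub>-\<^sub>m, K\<^sub>m)\<close>.  Since \<open>G\<close> is symmetric,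
  the degree of a vertex as an undirected graph is its out-degree.  The bound "degree at most
  \<open>m - 1\<close>" is written with \<open><\<close> to avoid truncated subtraction.
\<close>

definition split_graph :: "nat \<Rightarrow> nat \<Rightarrow> 'a pair_pre_digraph \<Rightarrow> bool" where
  "split_graph n m G \<longleftrightarrow>
     pair_graph G \<and> card (pverts G) = n \<and>
     (\<exists>I K. pverts G = I \<union> K \<and> I \<inter> K = {} \<and> card K = m \<and>
            is_clique G K \<and> is_independent G I \<and>
            (\<forall>v \<in> I. out_degree (with_proj G) v < m))"

definition contains_induced :: "'a pair_pre_digraph \<Rightarrow> 'b pair_pre_digraph \<Rightarrow> bool" where
  "contains_induced G T \<longleftrightarrow>
     (\<exists>H. induced_subgraph H (with_proj G) \<and> digraph_iso (with_proj T) H)"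

text \<open>
  The clique on \<open>{1, 2, 3, 4}\<close> with one additional vertex \<open>5 + k\<close> for each position \<open>k\<close> of the list
  \<open>Ns\<close>, whose neighbourhood is \<open>Ns ! k\<close> (assumed to be a subset of \<open>{1, 2, 3, 4}\<close>).
\<close>

definition K4_extension :: "nat set list \<Rightarrow> nat pair_pre_digraph" where
  "K4_extension Ns = \<lparr>
     pverts = {1..4} \<union> {5 + k | k. k < length Ns},
     parcs = {(i, j). i \<in> {1..4} \<and> j \<in> {1..4} \<and> i \<noteq> j}
           \<union> {(i, 5 + k) | i k. k < length Ns \<and> i \<in> Ns ! k}
           \<union> {(5 + k, i) | i k. k < length Ns \<and> i \<in> Ns ! k} \<rparr>"

definition T1 :: "nat pair_pre_digraph" where
  "T1 = K4_extension [{1, 2}, {2, 3}, {1, 3}]"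

definition T2 :: "nat pair_pre_digraph" where
  "T2 = K4_extension [{1, 2}, {2, 3}, {2, 4}]"

definition T3 :: "nat pair_pre_digraph" where
  "T3 = K4_extension [{1, 2, 3}, {1, 2, 4}, {2, 3, 4}]"

definition T4 :: "nat pair_pre_digraph" where
  "T4 = K4_extension [{1, 2}, {1, 4}, {1, 2, 3}, {1, 3, 4}]"

end

theory Submission
  imports Defs
begin

text \<open>
  In a word representing \<open>G\<close> the letters of the clique \<open>K\<^sub>4\<close> appear periodically, in a cyclic order
  \<open>a, b, c, d\<close>.  Comparing letter counts of prefixes shows that no independent vertex has neighbourhood
  \<open>{a, c}\<close> or \<open>{b, d}\<close>, and that the clique vertices missed by two neighbourhoods of size three never
  form an opposite pair; each \<open>T\<^sub>i\<close> violates this for all three cyclic orders.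

  Conversely, if no \<open>T\<^sub>i\<close> is induced, then the pairs that occur as neighbourhoods, together with the pair
  of vertices missed by the triples (if two are missed), contain neither a triangle nor a claw, so they
  lie on a 4-cycle of the clique.  After a rotation, \<open>b\<close> and \<open>c\<close> are not missed, and every neighbourhood
  is an interval of \<open>a, b, c, d\<close> or \<open>{a, d}\<close>.  Orient the clique along this order, make vertices of the
  first kind sources and route \<open>a \<rightarrow> z \<rightarrow> d\<close> through those of the second kind; a representing word is
  assembled from words compatible with this orientation, one for each non-adjacent pair.
\<close>

section \<open>Alternation and prefix counts\<close>

text \<open>\<open>leads w x y\<close>: the letters alternate in \<open>w\<close>, starting with \<open>x\<close> if either occurs.\<close>

definition leads :: "'a list \<Rightarrow> 'a \<Rightarrow> 'a \<Rightarrow> bool" where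
  "leads w x y \<longleftrightarrow> (\<forall>t. count_list (take t w) y \<le> count_list (take t w) x \<and>
     count_list (take t w) x \<le> count_list (take t w) y + 1)"

lemma leads_snoc:
  "leads (w @ [z]) x y \<longleftrightarrow> leads w x y \<and> count_list (w @ [z]) y \<le> count_list (w @ [z]) x \<and>
    count_list (w @ [z]) x \<le> count_list (w @ [z]) y + 1"
proof -
  let ?P = "\<lambda>u. count_list u y \<le> count_list u x \<and> count_list u x \<le> count_list u y + 1"
  have "?P (take t w)" if "\<And>t. ?P (take t (w @ [z]))" for t
    using that[of "min t (length w)"] by (simp add: min_def split: if_splits)
  moreover have "?P (w @ [z])" if "\<And>t. ?P (take t (w @ [z]))"
    using that[of "Suc (length w)"] by simp
  moreover have "?P (take t (w @ [z]))" if "\<And>t. ?P (take t w)" "?P (w @ [z])" for t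
  proof (cases "t \<le> length w")
    case True then show ?thesis using that(1)[of t] by simp
  next
    case False
    then have "take t (w @ [z]) = w @ [z]" by simp
    then show ?thesis using that(2) by simp
  qed
  ultimately have "(\<forall>t. ?P (take t (w @ [z]))) \<longleftrightarrow> (\<forall>t. ?P (take t w)) \<and> ?P (w @ [z])"
    by meson
  then show ?thesis unfolding leads_def by simp
qed

lemma alternating_word_Suc:
  "alternating_word x y (Suc l) = alternating_word x y l @ [if even l then x else y]"
  by (simp add: alternating_word_def)

lemma count_alternating_word:
  assumes "x \<noteq> y"
  shows "count_list (alternating_word x y l) x = (l + 1) div 2"
    and "count_list (alternating_word x y l) y = l div 2"
  using assms
  by (induction l) (auto simp: alternating_word_Suc, simp_all add: alternating_word_def)

text \<open>Induction from the right: after an alternating word of length \<open>l\<close> that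
  starts with \<open>x\<close>, the prefix bounds admit a further \<open>x\<close> exactly for even
  \<open>l\<close> and a further \<open>y\<close> exactly for odd \<open>l\<close>.\<close>

lemma leads_iff_alternating_word:
  assumes "x \<noteq> y"
  shows "leads w x y \<longleftrightarrow>
    filter (\<lambda>z. z \<in> {x, y}) w = alternating_word x y (count_list w x + count_list w y)"
proof (induction w rule: rev_induct)
  case Nil
  show ?case by (simp add: leads_def alternating_word_def)
next
  case (snoc z w)
  let ?F = "filter (\<lambda>z. z \<in> {x, y})"
  define l where "l = count_list w x + count_list w y"
  have cF: "count_list w x = count_list (?F w) x" "count_list w y = count_list (?F w) y"
    by (induction w) auto
  have c: "count_list w x = (l + 1) div 2 \<and> count_list w y = l div 2" if "leads w x y"
    using that cF count_alternating_word[OF assms, of l] snoc.IH by (simp add: l_def)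
  consider "z = x" | "z = y" | "z \<noteq> x" "z \<noteq> y" by blast
  then show ?case
  proof cases
    case 1
    have count: "count_list (w @ [z]) x = Suc (count_list w x)" "count_list (w @ [z]) y = count_list w y"
      using 1 assms by simp_all
    have "(l div 2 \<le> Suc ((l + 1) div 2) \<and> Suc ((l + 1) div 2) \<le> l div 2 + 1) = even l"
      by presburger
    then have "leads (w @ [z]) x y \<longleftrightarrow> leads w x y \<and> even l"
      unfolding leads_snoc count using c by metis
    also have "\<dots> \<longleftrightarrow> ?F (w @ [z]) = alternating_word x y (Suc l)"
      using 1 assms snoc.IH by (auto simp: alternating_word_Suc l_def)
    finally show ?thesis using 1 assms by (simp add: l_def)
  next
    case 2
    have count: "count_list (w @ [z]) x = count_list w x" "count_list (w @ [z]) y = Suc (count_list w y)"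
      using 2 assms by simp_all
    have "(Suc (l div 2) \<le> (l + 1) div 2 \<and> (l + 1) div 2 \<le> Suc (l div 2) + 1) = odd l"
      by presburger
    then have "leads (w @ [z]) x y \<longleftrightarrow> leads w x y \<and> odd l"
      unfolding leads_snoc count using c by metis
    also have "\<dots> \<longleftrightarrow> ?F (w @ [z]) = alternating_word x y (Suc l)"
      using 2 assms snoc.IH by (auto simp: alternating_word_Suc l_def)
    finally show ?thesis using 2 assms by (simp add: l_def)
  next
    case 3
    have "leads (w @ [z]) x y \<longleftrightarrow> leads w x y"
      unfolding leads_snoc using c 3 by (cases "leads w x y") simp_all
    then show ?thesis using 3 snoc.IH by simp
  qed
qed

lemma alternate_iff_leads:
  assumes "x \<noteq> y" shows "alternate w x y \<longleftrightarrow> leads w x y \<or> leads w y x"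
proof -
  have *: "leads w x y \<longleftrightarrow> (\<exists>l. filter (\<lambda>z. z \<in> {x, y}) w = alternating_word x y l)"
    if "x \<noteq> y" for x y
  proof
    assume "\<exists>l. filter (\<lambda>z. z \<in> {x, y}) w = alternating_word x y l"
    then obtain l where l: "filter (\<lambda>z. z \<in> {x, y}) w = alternating_word x y l" by blast
    have "count_list w x = count_list (filter (\<lambda>z. z \<in> {x, y}) w) x"
      "count_list w y = count_list (filter (\<lambda>z. z \<in> {x, y}) w) y"
      by (induction w) auto
    \<comment> \<open>The definition of alternation leaves the length open; the letter counts
      determine it.\<close>
    then have "count_list w x + count_list w y = l"
      using count_alternating_word[OF that, of l] l by simp
    with l show "leads w x y" using leads_iff_alternating_word[OF that] by simp
  qed (use leads_iff_alternating_word[OF that] in blast)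
  show ?thesis
    using *[OF assms] *[OF assms[symmetric]] unfolding alternate_def
    by (simp add: insert_commute) blast
qed

text \<open>In each prefix the counts decrease weakly from \<open>a\<close> to \<open>d\<close>, by
  at most 1 in total, so any two of them differ by at most 1. A path with an arc from its start to
  its end is therefore transitive, as in a semi-transitive orientation.\<close>

lemma leads_shortcut:
  assumes "leads w a b" "leads w b c" "leads w c d" "leads w a d"
  shows "leads w a c" "leads w b d"
proof -
  have "count_list (take t w) c \<le> count_list (take t w) a \<and>
      count_list (take t w) a \<le> count_list (take t w) c + 1 \<and>
      count_list (take t w) d \<le> count_list (take t w) b \<and>
      count_list (take t w) b \<le> count_list (take t w) d + 1" for t
    using assms[unfolded leads_def, THEN spec[of _ t]] by auto
  then show "leads w a c" "leads w b d" unfolding leads_def by auto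
qed

text \<open>Around a directed cycle the counts only decrease weakly, so they agree in every prefix,
  and then each letter leads each other one.\<close>

lemma leads_cycle:
  assumes "leads w a b" "leads w b c" "leads w c d" "leads w d a"
  shows "leads w b a" "leads w a c"
proof -
  have "count_list (take t w) b = count_list (take t w) a \<and>
      count_list (take t w) c = count_list (take t w) a" for t
    using assms[unfolded leads_def, THEN spec[of _ t]] by auto
  then show "leads w b a" "leads w a c" unfolding leads_def by simp_all
qed

lemma leads_refl: "leads w a a"
  by (simp add: leads_def)

text \<open>If \<open>c\<close> leads \<open>a\<close>, then \<open>a\<close>, \<open>b\<close>,
  \<open>c\<close>, \<open>c\<close> is a directed cycle and the counts agree in every prefix, so
  \<open>a\<close> leads \<open>c\<close> as well.\<close>

lemma leads_trans:
  assumes "leads w a b" "leads w b c" "leads w a c \<or> leads w c a"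
  shows "leads w a c"
  using assms leads_cycle(2)[of w a b c c] leads_refl[of w c] by blast

text \<open>
  In a labelled \<open>K\<^sub>4\<close>, \<open>p, q\<close> and \<open>r, s\<close> are possible pairs of opposite vertices in the cyclic order
  in which a word visits the clique.
\<close>

definition opposite_pairs :: "('a \<Rightarrow> 'a \<Rightarrow> bool) \<Rightarrow> 'a \<Rightarrow> 'a \<Rightarrow> 'a \<Rightarrow> 'a \<Rightarrow> bool" where
  "opposite_pairs A p q r s \<longleftrightarrow>
     (\<forall>x. x \<notin> {p, q, r, s} \<longrightarrow> \<not> (A x p \<and> A x q \<and> \<not> A x r \<and> \<not> A x s)) \<and>
     (\<forall>x y. x \<notin> {p, q, r, s} \<and> y \<notin> {p, q, r, s} \<and> x \<noteq> y \<and> \<not> A x y \<longrightarrow>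
        \<not> (A x r \<and> A x s \<and> A x p \<and> \<not> A x q \<and> A y r \<and> A y s \<and> A y q \<and> \<not> A y p))"

section \<open>The order of the clique letters in a word\<close>

lemma ex_sorted_wrt:
  assumes "\<And>x y. x \<in> set xs \<Longrightarrow> y \<in> set xs \<Longrightarrow> R x y \<or> R y x"
    and "\<And>x y z. x \<in> set xs \<Longrightarrow> y \<in> set xs \<Longrightarrow> z \<in> set xs \<Longrightarrow> R x y \<Longrightarrow> R y z \<Longrightarrow> R x z"
  shows "\<exists>ys. set ys = set xs \<and> length ys = length xs \<and> sorted_wrt R ys"
  using assms
proof (induction xs)
  case Nil
  show ?case by (rule exI[of _ "[]"]) simp
next
  case (Cons x xs)
  have "\<exists>ys. set ys = set xs \<and> length ys = length xs \<and> sorted_wrt R ys"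
    by (rule Cons.IH) (use Cons.prems in \<open>meson list.set_intros(2)\<close>)+
  then obtain ys where ys: "set ys = set xs" "length ys = length xs" "sorted_wrt R ys" by blast
  \<comment> \<open>Insertion of \<open>x\<close>: by totality the elements put in front are related
    to \<open>x\<close>, and by transitivity also to those put behind it.\<close>
  define zs where "zs = filter (\<lambda>y. \<not> R x y) ys @ x # filter (R x) ys"
  have "R y x" if "y \<in> set ys" "\<not> R x y" for y
    using Cons.prems(1)[of x y] that ys(1) by simp
  moreover have "R y z" if "y \<in> set ys" "z \<in> set ys" "R y x" "R x z" for y z
    using Cons.prems(2)[of y x z] that ys(1) by simp
  ultimately have "sorted_wrt R zs"
    using ys(3) by (simp add: zs_def sorted_wrt_append sorted_wrt_filter)
  moreover have "set zs = set (x # xs)" using ys(1) by (auto simp: zs_def)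
  moreover have "length zs = length (x # xs)"
    using ys(2) sum_length_filter_compl[of "R x" ys] by (simp add: zs_def)
  ultimately show ?case by blast
qed

text \<open>Pairwise alternation makes \<open>leads w\<close> total on the four letters, and
  \<open>leads_trans\<close> makes it transitive there, so they can be sorted.\<close>

lemma leads_order4:
  assumes "\<And>x y. x \<in> {p, q, r, s} \<Longrightarrow> y \<in> {p, q, r, s} \<Longrightarrow> leads w x y \<or> leads w y x"
  obtains a b c d where "{a, b, c, d} = {p, q, r, s}"
    "leads w a b" "leads w a c" "leads w a d" "leads w b c" "leads w b d" "leads w c d"
proof -
  have "\<exists>ys. set ys = set [p, q, r, s] \<and> length ys = length [p, q, r, s] \<and> sorted_wrt (leads w) ys"
  proof (rule ex_sorted_wrt)
    show "leads w x y \<or> leads w y x" if "x \<in> set [p, q, r, s]" "y \<in> set [p, q, r, s]" for x y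
      using assms[of x y] that by simp
    show "leads w x z" if "x \<in> set [p, q, r, s]" "z \<in> set [p, q, r, s]" "leads w x y" "leads w y z"
      for x y z
      using assms[of x z] that by (intro leads_trans[of w x y z]) simp_all
  qed
  then obtain ys where "set ys = {p, q, r, s}" "length ys = 4" "sorted_wrt (leads w) ys" by auto
  moreover from this obtain a b c d where "ys = [a, b, c, d]"
    by (auto simp: length_Suc_conv numeral_eq_Suc)
  ultimately show thesis by (intro that[of a b c d]) simp_all
qed

text \<open>A letter adjacent to two opposite clique letters, but not to the one between them in the
  order, can itself only lie between them: every other position yields a shortcut or a directed
  cycle.\<close>

lemma opposite_pairs_of_order:
  assumes "leads w a b" "leads w a c" "leads w a d" "leads w b c" "leads w b d" "leads w c d"
  defines "A \<equiv> \<lambda>x y. leads w x y \<or> leads w y x"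
  shows "opposite_pairs A a c b d \<and> opposite_pairs A b d a c"
proof -
  \<comment> \<open>If \<open>x\<close> came before both \<open>a\<close> and \<open>c\<close>, or
    after both, a shortcut would make it adjacent to \<open>b\<close>; if it came after
    \<open>c\<close> and before \<open>a\<close>, a directed cycle would.\<close>
  have ac: "leads w a x \<and> leads w x c" if "A x a" "A x c" "\<not> A x b" for x
  proof -
    have "\<not> (leads w x a \<and> leads w x c)"
      using leads_shortcut(1)[of w x a b c] assms that(3) by (auto simp: A_def)
    moreover have "\<not> (leads w a x \<and> leads w c x)"
      using leads_shortcut(2)[of w a b c x] assms that(3) by (auto simp: A_def)
    moreover have "\<not> (leads w x a \<and> leads w c x)"
      using leads_cycle(2)[of w x a b c] assms that(3) leads_cycle(2)[of w a b c x]
      leads_cycle(2)[of w x a b c] leads_cycle(1)[of w b c x a]  leads_cycle(2)[of w b c x a]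
      by (auto simp: A_def)
    ultimately show ?thesis using that by (auto simp: A_def)
  qed
  have bd: "leads w b x \<and> leads w x d" if "A x b" "A x d" "\<not> A x c" for x
  proof -
    have "\<not> (leads w x b \<and> leads w x d)"
      using leads_shortcut(1)[of w x b c d] assms that(3) by (auto simp: A_def)
    moreover have "\<not> (leads w b x \<and> leads w d x)"
      using leads_shortcut(2)[of w b c d x] assms that(3) by (auto simp: A_def)
    moreover have "\<not> (leads w x b \<and> leads w d x)"
      using leads_cycle(2)[of w x b c d] assms that(3) by (auto simp: A_def)
    ultimately show ?thesis using that by (auto simp: A_def)
  qed
  \<comment> \<open>The path \<open>a\<close>, \<open>x\<close>, \<open>c\<close>, \<open>d\<close>
    has an arc from \<open>a\<close> to \<open>d\<close>, so it also has one from \<open>x\<close>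
    to \<open>d\<close>.\<close>
  have ac_d: "A x d" if "leads w a x" "leads w x c" for x
    using leads_shortcut(2)[of w a x c d] assms that by (auto simp: A_def)
  have bd_a: "A x a" if "leads w b x" "leads w x d" for x
    using leads_shortcut(1)[of w a b x d] assms that by (auto simp: A_def)
  \<comment> \<open>By \<open>ac\<close>, \<open>x\<close> lies between \<open>a\<close> and
    \<open>c\<close>; by \<open>ac_d\<close>, \<open>y\<close> does not. In each remaining position
    of \<open>y\<close>, a shortcut or a cycle through \<open>a\<close>, \<open>x\<close>,
    \<open>c\<close> makes \<open>y\<close> adjacent to \<open>x\<close>.\<close>
  have 1: False if x: "A x a" "A x c" "A x d" "\<not> A x b" and y: "A y a" "A y c" "\<not> A y d"
      and n: "\<not> A x y" for x y
  proof -
    note xx = ac[OF x(1,2,4)]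
    have "\<not> (leads w a y \<and> leads w y c)" using ac_d y by blast
    then consider "leads w y a" "leads w y c" | "leads w a y" "leads w c y" | "leads w y a" "leads w c y"
      using y by (auto simp: A_def)
    then show False
    proof cases
      case 1 then show False using leads_shortcut(1)[of w y a x c] xx n by (auto simp: A_def)
    next
      case 2 then show False using leads_shortcut(2)[of w a x c y] xx n by (auto simp: A_def)
    next
      case 3 then show False using leads_cycle(2)[of w y a x c] xx n by (auto simp: A_def)
    qed
  qed
  have 2: False if x: "A x a" "A x b" "A x d" "\<not> A x c" and y: "A y b" "A y d" "\<not> A y a"
      and n: "\<not> A x y" for x y
  proof -
    note xx = bd[OF x(2,3,4)]
    have "\<not> (leads w b y \<and> leads w y d)" using bd_a y by blast
    then consider "leads w y b" "leads w y d" | "leads w b y" "leads w d y" | "leads w y b" "leads w d y"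
      using y by (auto simp: A_def)
    then show False
    proof cases
      case 1 then show False using leads_shortcut(1)[of w y b x d] xx n by (auto simp: A_def)
    next
      case 2 then show False using leads_shortcut(2)[of w b x d y] xx n by (auto simp: A_def)
    next
      case 3 then show False using leads_cycle(2)[of w y b x d] xx n by (auto simp: A_def)
    qed
  qed
  have sym: "A y x" if "A x y" for x y using that by (auto simp: A_def)
  have 3: False if "A x a" "A x c" "\<not> A x b" "\<not> A x d" for x
    using ac[OF that(1-3)] ac_d[of x] that(4) by blast
  have 4: False if "A x b" "A x d" "\<not> A x a" "\<not> A x c" for x
    using bd[OF that(1,2,4)] bd_a[of x] that(3) by blast
  have "opposite_pairs A a c b d"
    unfolding opposite_pairs_def
  proof (intro conjI allI impI notI; elim conjE)
    show False if "A x a" "A x c" "\<not> A x b" "\<not> A x d" for x by (rule 3[OF that])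
    show False if "\<not> A x y" "A x b" "A x d" "A x a" "\<not> A x c" "A y b" "A y d" "A y c" "\<not> A y a"
      for x y by (rule 2[of x y]) (fact that)+
  qed
  moreover have "opposite_pairs A b d a c"
    unfolding opposite_pairs_def
  proof (intro conjI allI impI notI; elim conjE)
    show False if "A x b" "A x d" "\<not> A x a" "\<not> A x c" for x by (rule 4[OF that])
    show False if "\<not> A x y" "A x a" "A x c" "A x b" "\<not> A x d" "A y a" "A y c" "A y d" "\<not> A y b"
      for x y using 1[of y x] that sym[of y x] by blast
  qed
  ultimately show ?thesis ..
qed

section \<open>Induced subgraphs\<close>

text \<open>Compatibility with \<open>G\<close> forces the tail and head maps of \<open>H\<close> to
  be \<open>fst\<close> and \<open>snd\<close>, so on the arcs of \<open>T\<close> the arc map of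
  the isomorphism is determined by its vertex map.\<close>

lemma digraph_iso_with_proj_embedding:
  assumes "digraph_iso (with_proj T) H" "induced_subgraph H (with_proj G)"
  obtains f where "inj_on f (pverts T)" "f ` pverts T \<subseteq> pverts G"
    "\<And>x y. x \<in> pverts T \<Longrightarrow> y \<in> pverts T \<Longrightarrow> (x, y) \<in> parcs T \<longleftrightarrow> (f x, f y) \<in> parcs G"
proof -
  obtain h where h: "pre_digraph.digraph_isomorphism (with_proj T) h" "H = app_iso h (with_proj T)"
    using assms(1) unfolding digraph_iso_def by blast
  let ?f = "iso_verts h"
  have comp: "iso_tail h = fst" "iso_head h = snd"
    and vs: "?f ` pverts T \<subseteq> pverts G"
    and as: "iso_arcs h ` parcs T = {e \<in> parcs G. fst e \<in> ?f ` pverts T \<and> snd e \<in> ?f ` pverts T}"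
    using assms(2) unfolding h(2) induced_subgraph_def subgraph_def compatible_def by auto
  have inj: "inj_on ?f (pverts T)" and wf: "wf_digraph (with_proj T)"
    and arc: "\<And>e. e \<in> parcs T \<Longrightarrow> iso_arcs h e = (?f (fst e), ?f (snd e))"
    using h(1) comp unfolding pre_digraph.digraph_isomorphism_def by (auto simp: prod_eq_iff)
  interpret T: pair_wf_digraph T using wf wf_digraph_wp_iff by blast
  have "(x, y) \<in> parcs T \<longleftrightarrow> (?f x, ?f y) \<in> parcs G" if xy: "x \<in> pverts T" "y \<in> pverts T" for x y
  proof
    assume a: "(x, y) \<in> parcs T"
    then have "iso_arcs h (x, y) \<in> parcs G" using as by blast
    then show "(?f x, ?f y) \<in> parcs G" using arc[OF a] by simp
  next
    assume "(?f x, ?f y) \<in> parcs G"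
    then have "(?f x, ?f y) \<in> iso_arcs h ` parcs T" unfolding as using xy by simp
    then obtain e where e: "e \<in> parcs T" "(?f x, ?f y) = iso_arcs h e" by blast
    then have "?f x = ?f (fst e)" "?f y = ?f (snd e)" using arc by auto
    then have "(x, y) = e"
      using inj xy T.arc_fst_in_verts T.arc_snd_in_verts e(1) by (metis inj_on_eq_iff prod.collapse)
    then show "(x, y) \<in> parcs T" using e by simp
  qed
  then show thesis using that inj vs by blast
qed

text \<open>The isomorphism acts by \<open>f\<close> on vertices and by \<open>map_prod f f\<close>
  on arcs; preservation and reflection of arcs make its image exactly the arcs of \<open>G\<close>
  inside the image of \<open>f\<close>.\<close>

lemma contains_inducedI:
  assumes G: "pair_wf_digraph G" and T: "pair_wf_digraph T"
    and f: "inj_on f (pverts T)" "f ` pverts T \<subseteq> pverts G"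
    "\<And>x y. x \<in> pverts T \<Longrightarrow> y \<in> pverts T \<Longrightarrow> (x, y) \<in> parcs T \<longleftrightarrow> (f x, f y) \<in> parcs G"
  shows "contains_induced G T"
proof -
  interpret G: pair_wf_digraph G by (rule G)
  interpret T: pair_wf_digraph T by (rule T)
  let ?h = "\<lparr>iso_verts = f, iso_arcs = map_prod f f, iso_head = snd, iso_tail = fst\<rparr>"
  let ?H = "app_iso ?h (with_proj T)"
  have "inj_on (map_prod f f) (parcs T)"
    by (rule inj_on_subset[OF map_prod_inj_on[OF f(1) f(1)]]) (auto dest: T.wellformed')
  then have h: "pre_digraph.digraph_isomorphism (with_proj T) ?h"
    using f(1) T by (auto simp: pre_digraph.digraph_isomorphism_def wf_digraph_wp_iff)
  have wfT: "wf_digraph (with_proj T)" using T by (simp add: wf_digraph_wp_iff)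
  have "wf_digraph ?H" by (rule wf_digraph.wf_digraphI_app_iso[OF wfT h])
  moreover have "arcs ?H = {e \<in> parcs G. fst e \<in> f ` pverts T \<and> snd e \<in> f ` pverts T}"
  proof (intro equalityI subsetI)
    fix e assume "e \<in> arcs ?H"
    then obtain x y where xy: "(x, y) \<in> parcs T" "e = (f x, f y)" by auto
    then have "x \<in> pverts T" "y \<in> pverts T" using T.wellformed' by blast+
    then show "e \<in> {e \<in> parcs G. fst e \<in> f ` pverts T \<and> snd e \<in> f ` pverts T}"
      using xy f(3) by simp
  next
    fix e assume "e \<in> {e \<in> parcs G. fst e \<in> f ` pverts T \<and> snd e \<in> f ` pverts T}"
    then obtain x y where xy: "x \<in> pverts T" "y \<in> pverts T" "fst e = f x" "snd e = f y"
        and e: "e \<in> parcs G" by blast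
    then have eq: "e = (f x, f y)" by (simp add: prod_eq_iff)
    then have "map_prod f f (x, y) \<in> map_prod f f ` parcs T"
      using f(3)[OF xy(1,2)] e by (intro imageI) simp
    then show "e \<in> arcs ?H" by (simp add: eq)
  qed
  moreover have "wf_digraph (with_proj G)" using G by (simp add: wf_digraph_wp_iff)
  ultimately have "induced_subgraph ?H (with_proj G)"
    using f(2) unfolding induced_subgraph_def subgraph_def compatible_def by auto
  with h show ?thesis
    unfolding contains_induced_def digraph_iso_def by blast
qed

section \<open>Word-representability of induced subgraphs\<close>

lemma alternate_map_inj:
  assumes "inj_on f (set w \<union> {x, y})"
  shows "alternate (map f w) (f x) (f y) \<longleftrightarrow> alternate w x y"
proof -
  have F: "filter (\<lambda>z. z \<in> {f x, f y}) (map f w) = map f (filter (\<lambda>z. z \<in> {x, y}) w)"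
    unfolding filter_map comp_def using assms
    by (intro arg_cong[of _ _ "map f"] filter_cong refl) (auto simp: inj_on_def)
  have eq: "map f (filter (\<lambda>z. z \<in> {x, y}) w) = alternating_word (f u) (f v) l \<longleftrightarrow>
    filter (\<lambda>z. z \<in> {x, y}) w = alternating_word u v l" if "{u, v} = {x, y}" for u v l
  proof -
    have "set (alternating_word u v l) \<subseteq> {u, v}" by (auto simp: alternating_word_def)
    then have "set (filter (\<lambda>z. z \<in> {x, y}) w) \<union> set (alternating_word u v l) \<subseteq> set w \<union> {x, y}"
      using that by auto
    moreover have "alternating_word (f u) (f v) l = map f (alternating_word u v l)"
      by (simp add: alternating_word_def)
    ultimately show ?thesis
      using inj_on_map_eq_map[OF inj_on_subset[OF assms]] by simp
  qed
  show ?thesis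
    unfolding alternate_def F eq[OF refl] eq[OF insert_commute] by (rule refl)
qed

lemma alternate_filter:
  assumes "P x" "P y" shows "alternate (filter P w) x y \<longleftrightarrow> alternate w x y"
proof -
  have "filter (\<lambda>z. z \<in> {x, y}) (filter P w) = filter (\<lambda>z. z \<in> {x, y}) w"
    using assms by (auto simp: filter_filter intro: filter_cong)
  then show ?thesis by (simp add: alternate_def)
qed

text \<open>Restrict a word for \<open>G\<close> to the letters of the copy of \<open>T\<close> and
  rename them by the inverse of the embedding; neither operation affects the alternation of the
  remaining letters.\<close>

lemma word_representable_induced:
  assumes G: "word_representable G" and T: "contains_induced G T"
  shows "word_representable T"
proof -
  obtain f where f: "inj_on f (pverts T)" "f ` pverts T \<subseteq> pverts G"
    "\<And>x y. x \<in> pverts T \<Longrightarrow> y \<in> pverts T \<Longrightarrow> (x, y) \<in> parcs T \<longleftrightarrow> (f x, f y) \<in> parcs G"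
    using T digraph_iso_with_proj_embedding unfolding contains_induced_def by metis
  obtain w where w: "set w = pverts G" "\<And>x y. x \<in> pverts G \<Longrightarrow> y \<in> pverts G \<Longrightarrow> x \<noteq> y \<Longrightarrow>
      alternate w x y \<longleftrightarrow> (x, y) \<in> parcs G"
    using G unfolding word_representable_def by blast
  define g where "g = the_inv_into (pverts T) f"
  define w' where "w' = filter (\<lambda>z. z \<in> f ` pverts T) w"
  have gf: "g (f x) = x" if "x \<in> pverts T" for x
    using that f(1) by (simp add: g_def the_inv_into_f_f)
  have setw': "set w' = f ` pverts T" using f(2) w(1) by (auto simp: w'_def)
  have "set (map g w') = pverts T" using gf by (force simp: setw')
  moreover have "alternate (map g w') x y \<longleftrightarrow> (x, y) \<in> parcs T"
    if xy: "x \<in> pverts T" "y \<in> pverts T" "x \<noteq> y" for x y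
  proof -
    have "inj_on g (f ` pverts T)" using f(1) by (simp add: g_def inj_on_the_inv_into)
    then have "inj_on g (set w' \<union> {f x, f y})" using xy setw' by (simp add: insert_absorb)
    then have "alternate (map g w') (g (f x)) (g (f y)) \<longleftrightarrow> alternate w' (f x) (f y)"
      by (rule alternate_map_inj)
    also have "\<dots> \<longleftrightarrow> alternate w (f x) (f y)"
      unfolding w'_def using xy by (intro alternate_filter) auto
    also have "\<dots> \<longleftrightarrow> (f x, f y) \<in> parcs G"
      using xy f(1,2) by (intro w) (auto simp: inj_on_eq_iff)
    finally show ?thesis using xy gf f(3) by simp
  qed
  ultimately show ?thesis unfolding word_representable_def by blast
qed

section \<open>The four obstructions\<close>

text \<open>The necessary condition on the set \<open>S\<close> of neighbourhoods when
  \<open>{p, q}\<close> and \<open>{r, s}\<close> are the opposite pairs of the cyclic order: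
  neither is a neighbourhood, and neither consists of the vertices missed by two triples.\<close>

definition balanced :: "nat set set \<Rightarrow> nat \<Rightarrow> nat \<Rightarrow> nat \<Rightarrow> nat \<Rightarrow> bool" where
  "balanced S p q r s \<longleftrightarrow> {p, q} \<notin> S \<and> {r, s} \<notin> S \<and>
     \<not> ({r, s, p} \<in> S \<and> {r, s, q} \<in> S) \<and> \<not> ({p, q, r} \<in> S \<and> {p, q, s} \<in> S)"

text \<open>Through these symmetries only the splitting into opposite pairs matters, which reduces
  the 24 orders of the clique to three cases.\<close>

lemma balanced_commute:
  "balanced S p q r s = balanced S q p r s" "balanced S p q r s = balanced S p q s r"
  "balanced S p q r s = balanced S r s p q"
  unfolding balanced_def by (auto simp: insert_commute)

lemma pverts_K4_extension: "pverts (K4_extension Ns) = {1..4 + length Ns}"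
proof -
  have "{5 + k | k. k < length Ns} = {5..4 + length Ns}"
  proof (intro equalityI subsetI)
    fix x assume "x \<in> {5..4 + length Ns}"
    then show "x \<in> {5 + k | k. k < length Ns}" by (intro CollectI exI[of _ "x - 5"]) auto
  qed auto
  then show ?thesis by (auto simp: K4_extension_def)
qed

lemma parcs_K4_extension:
  assumes "\<Union> (set Ns) \<subseteq> {1..4}"
  shows "i \<in> {1..4} \<Longrightarrow> j \<in> {1..4} \<Longrightarrow> (i, j) \<in> parcs (K4_extension Ns) \<longleftrightarrow> i \<noteq> j"
    and "i \<in> {1..4} \<Longrightarrow> k < length Ns \<Longrightarrow> (i, 5 + k) \<in> parcs (K4_extension Ns) \<longleftrightarrow> i \<in> Ns ! k"
    and "i \<in> {1..4} \<Longrightarrow> k < length Ns \<Longrightarrow> (5 + k, i) \<in> parcs (K4_extension Ns) \<longleftrightarrow> i \<in> Ns ! k"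
    and "j < length Ns \<Longrightarrow> k < length Ns \<Longrightarrow> (5 + j, 5 + k) \<notin> parcs (K4_extension Ns)"
proof -
  have "Ns ! k \<subseteq> {1..4}" if "k < length Ns" for k using assms that nth_mem by blast
  \<comment> \<open>No additional vertex is an element of a neighbourhood, so the arcs listed for
    the neighbourhoods never join two additional vertices.\<close>
  then have "5 + l \<notin> Ns ! k" if "k < length Ns" for k l using that by fastforce
  then show "j < length Ns \<Longrightarrow> k < length Ns \<Longrightarrow> (5 + j, 5 + k) \<notin> parcs (K4_extension Ns)"
    by (auto simp: K4_extension_def)
qed (auto simp: K4_extension_def)

lemma pair_wf_digraph_K4_extension:
  assumes "\<Union> (set Ns) \<subseteq> {1..4}" shows "pair_wf_digraph (K4_extension Ns)"
proof -
  have "Ns ! k \<subseteq> {1..4}" if "k < length Ns" for k using assms that nth_mem by blast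
  then show ?thesis
    by unfold_locales (fastforce simp: K4_extension_def)+
qed

text \<open>Sorting the clique letters of a word gives an order whose opposite pairs are
  \<open>a, c\<close> and \<open>b, d\<close>; the three disjuncts are the possible partners of
  1.\<close>

lemma balanced_if_word_representable:
  assumes Ns: "\<Union> (set Ns) \<subseteq> {1..4}" and rep: "word_representable (K4_extension Ns)"
  shows "balanced (set Ns) 1 2 3 4 \<or> balanced (set Ns) 1 3 2 4 \<or> balanced (set Ns) 1 4 2 3"
proof -
  note arcs = parcs_K4_extension[OF Ns]
  obtain w where w: "\<And>x y. x \<in> {1..4 + length Ns} \<Longrightarrow> y \<in> {1..4 + length Ns} \<Longrightarrow> x \<noteq> y \<Longrightarrow>
      alternate w x y \<longleftrightarrow> (x, y) \<in> parcs (K4_extension Ns)"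
    using rep unfolding word_representable_def pverts_K4_extension by blast
  define A where "A = (\<lambda>x y. leads w x y \<or> leads w y x)"
  have A: "A x y \<longleftrightarrow> (x, y) \<in> parcs (K4_extension Ns)"
    if "x \<in> {1..4 + length Ns}" "y \<in> {1..4 + length Ns}" "x \<noteq> y" for x y
    using w[OF that] alternate_iff_leads[OF that(3)] by (simp add: A_def)
  have "leads w x y \<or> leads w y x" if "x \<in> {1, 2, 3, 4}" "y \<in> {1, 2, 3, 4}" for x y
  proof (cases "x = y")
    case False
    then show ?thesis using A[of x y] arcs(1)[of x y] that by (auto simp: A_def)
  qed (simp add: leads_def)
  then obtain a b c d where abcd: "{a, b, c, d} = {1, 2, 3, 4}"
    and l: "leads w a b" "leads w a c" "leads w a d" "leads w b c" "leads w b d" "leads w c d"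
    by (rule leads_order4)
  \<comment> \<open>This reads \<open>opposite_pairs\<close> in terms of neighbourhoods:
    \<open>5 + k\<close> is adjacent to exactly the clique vertices in
    \<open>Ns ! k\<close>.\<close>
  have opp: "{p, q} \<notin> set Ns \<and> \<not> ({r, s, p} \<in> set Ns \<and> {r, s, q} \<in> set Ns)"
    if o: "opposite_pairs A p q r s" and K: "{p, q, r, s} = {1, 2, 3, 4}" for p q r s
  proof -
    have "card {p, q, r, s} = card (set [1, 2, 3, 4 :: nat])" using K by simp
    then have dist: "distinct [p, q, r, s]" by (intro card_distinct) simp
    have in14: "{p, q, r, s} \<subseteq> {1..4}" using K by auto
    have ext: "A (5 + k) i \<longleftrightarrow> i \<in> Ns ! k" if "k < length Ns" "i \<in> {p, q, r, s}" for k i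
      using A[of "5 + k" i] arcs(3)[of i k] that in14 by auto
    have out: "5 + k \<notin> {p, q, r, s}" for k using in14 by auto
    have "{p, q} \<notin> set Ns"
    proof
      assume "{p, q} \<in> set Ns"
      then obtain k where k: "k < length Ns" "Ns ! k = {p, q}" by (meson in_set_conv_nth)
      then have "A (5 + k) p" "A (5 + k) q" "\<not> A (5 + k) r" "\<not> A (5 + k) s"
        using ext[OF k(1)] dist by auto
      then show False using o out[of k] unfolding opposite_pairs_def by blast
    qed
    moreover have "\<not> ({r, s, p} \<in> set Ns \<and> {r, s, q} \<in> set Ns)"
    proof
      assume "{r, s, p} \<in> set Ns \<and> {r, s, q} \<in> set Ns"
      then obtain j k where jk: "j < length Ns" "Ns ! j = {r, s, p}" "k < length Ns" "Ns ! k = {r, s, q}"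
        by (meson in_set_conv_nth)
      then have x: "A (5 + j) r" "A (5 + j) s" "A (5 + j) p" "\<not> A (5 + j) q"
        and y: "A (5 + k) r" "A (5 + k) s" "A (5 + k) q" "\<not> A (5 + k) p"
        using ext[OF jk(1)] ext[OF jk(3)] dist by auto
      \<comment> \<open>The two vertices differ because only the first is adjacent to
        \<open>p\<close>; being additional vertices, they are then non-adjacent, as the second
        clause of \<open>opposite_pairs\<close> demands.\<close>
      then have "5 + j \<noteq> 5 + k" by auto
      moreover from this have "\<not> A (5 + j) (5 + k)"
        using A[of "5 + j" "5 + k"] arcs(4)[of j k] jk by simp
      ultimately show False
        using o out[of j] out[of k] x y unfolding opposite_pairs_def by blast
    qed
    ultimately show ?thesis by blast
  qed
  have "opposite_pairs A a c b d \<and> opposite_pairs A b d a c"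
    unfolding A_def by (rule opposite_pairs_of_order[OF l])
  moreover have "{a, c, b, d} = {1, 2, 3, 4}" "{b, d, a, c} = {1, 2, 3, 4}"
    using abcd by (simp_all add: insert_commute)
  ultimately have bal: "balanced (set Ns) a c b d"
    using opp[of a c b d] opp[of b d a c] unfolding balanced_def by (simp add: insert_commute)
  have "card {a, b, c, d} = card (set [1, 2, 3, 4 :: nat])" using abcd by simp
  then have dist: "distinct [a, b, c, d]" by (intro card_distinct) simp
  have one: ?thesis if b: "balanced (set Ns) 1 q r s" and d: "distinct [1, q, r, s]"
    and e: "{q, r, s} \<subseteq> {1, 2, 3, 4}" for q r s
  proof -
    have "(q = 2 \<and> r = 3 \<and> s = 4) \<or> (q = 2 \<and> r = 4 \<and> s = 3) \<or> (q = 3 \<and> r = 2 \<and> s = 4) \<or>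
      (q = 3 \<and> r = 4 \<and> s = 2) \<or> (q = 4 \<and> r = 2 \<and> s = 3) \<or> (q = 4 \<and> r = 3 \<and> s = 2)"
      using d e by auto
    then show ?thesis using b balanced_commute(2) by blast
  qed
  have sub: "{a, b, c, d} \<subseteq> {1, 2, 3, 4}" using abcd by simp
  \<comment> \<open>The symmetries of \<open>balanced\<close> move 1 to the first place, wherever it
    stands in the order.\<close>
  have "1 \<in> {a, b, c, d}" unfolding abcd by simp
  then consider "a = 1" | "b = 1" | "c = 1" | "d = 1" by blast
  then show ?thesis
  proof cases
    case 1 then show ?thesis using one[of c b d] bal dist sub by simp
  next
    case 2 then show ?thesis
      using one[of d a c] bal dist sub balanced_commute(3)[of "set Ns" a c b d] by simp
  next
    case 3 then show ?thesis
      using one[of a b d] bal dist sub balanced_commute(1)[of "set Ns" a c b d] by simp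
  next
    case 4 then show ?thesis
      using one[of b a c] bal dist sub balanced_commute(3)[of "set Ns" a c b d]
        balanced_commute(1)[of "set Ns" b d a c] by simp
  qed
qed

text \<open>Each splitting of the clique into opposite pairs is violated. In \<open>T1\<close> and
  \<open>T2\<close> the three pairs hit one splitting each. In \<open>T3\<close> the missed vertices
  4, 3, 1 contain an opposite pair of every splitting. In \<open>T4\<close> the pairs exclude two
  splittings, and the triples, which miss 4 and 2, exclude the third.\<close>

lemma not_word_representable_T:
  "\<not> word_representable T1" "\<not> word_representable T2"
  "\<not> word_representable T3" "\<not> word_representable T4"
  unfolding T1_def T2_def T3_def T4_def
  by (rule notI, drule balanced_if_word_representable[rotated],
      simp, simp add: balanced_def insert_commute doubleton_eq_iff; force)+

section \<open>Words from orientations\<close>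

lemma alternating_word_no_repeat:
  assumes "x \<noteq> y" shows "alternating_word x y l \<noteq> p @ [z, z] @ q"
proof
  assume eq: "alternating_word x y l = p @ [z, z] @ q"
  have len: "length p + 2 \<le> l"
    using arg_cong[OF eq, of length] by (simp add: alternating_word_def)
  have "alternating_word x y l ! length p = z" "alternating_word x y l ! Suc (length p) = z"
    unfolding eq by (simp_all add: nth_append)
  then show False
    using len assms by (auto simp: alternating_word_def split: if_splits)
qed

lemma concat_replicate_alternating: "concat (replicate k [u, v]) = alternating_word u v (2 * k)"
proof (induction k)
  case (Suc k)
  have "concat (replicate (Suc k) [u, v]) = concat (replicate k [u, v]) @ [u, v]"
    by (simp flip: replicate_append_same)
  with Suc show ?case
    by (simp add: alternating_word_def)
qed (simp add: alternating_word_def)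

lemma sorted_wrt_if_all:
  "(\<And>u v. u \<in> set xs \<Longrightarrow> v \<in> set xs \<Longrightarrow> R u v) \<Longrightarrow> sorted_wrt R xs"
  by (induction xs) auto

lemma filter_pair_distinct:
  assumes "distinct xs"
  shows "v \<notin> set xs \<Longrightarrow> filter (\<lambda>z. z = u \<or> z = v) xs = (if u \<in> set xs then [u] else [])"
    and "u \<notin> set xs \<Longrightarrow> filter (\<lambda>z. z = u \<or> z = v) xs = (if v \<in> set xs then [v] else [])"
  using assms by (induction xs) auto

text \<open>
  Words in which every arc \<open>u \<rightarrow> v\<close> restricts to \<open>(uv)\<^sup>k\<close> can be concatenated without destroying
  the alternation of adjacent letters, so it suffices to break each non-adjacent pair in one of them.
\<close>

definition word_respects :: "('a \<Rightarrow> 'a \<Rightarrow> bool) \<Rightarrow> 'a list \<Rightarrow> bool" where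
  "word_respects D w \<longleftrightarrow> (\<forall>u v. D u v \<longrightarrow> (\<exists>k. filter (\<lambda>z. z \<in> {u, v}) w = concat (replicate k [u, v])))"

text \<open>A repeated letter in the restriction certifies non-alternation and persists when words
  are added on either side.\<close>

definition breaks :: "'a list \<Rightarrow> 'a \<Rightarrow> 'a \<Rightarrow> bool" where
  "breaks w x y \<longleftrightarrow> (\<exists>p z q. filter (\<lambda>z. z \<in> {x, y}) w = p @ [z, z] @ q)"

lemma word_respects_Nil: "word_respects D []"
  unfolding word_respects_def by (auto intro: exI[of _ 0])

lemma word_respects_append:
  assumes "word_respects D v" "word_respects D w" shows "word_respects D (v @ w)"
  unfolding word_respects_def
proof (intro allI impI)
  fix x y assume "D x y"
  with assms obtain k l where
    "filter (\<lambda>z. z \<in> {x, y}) v = concat (replicate k [x, y])"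
    "filter (\<lambda>z. z \<in> {x, y}) w = concat (replicate l [x, y])"
    unfolding word_respects_def by meson
  then have "filter (\<lambda>z. z \<in> {x, y}) (v @ w) = concat (replicate (k + l) [x, y])"
    by (simp add: replicate_add)
  then show "\<exists>k. filter (\<lambda>z. z \<in> {x, y}) (v @ w) = concat (replicate k [x, y])" by blast
qed

lemma breaks_append:
  assumes "breaks w x y" shows "breaks (u @ w @ v) x y"
proof -
  obtain p z q where "filter (\<lambda>z. z \<in> {x, y}) w = p @ [z, z] @ q"
    using assms unfolding breaks_def by blast
  then have "filter (\<lambda>z. z \<in> {x, y}) (u @ w @ v) =
      (filter (\<lambda>z. z \<in> {x, y}) u @ p) @ [z, z] @ (q @ filter (\<lambda>z. z \<in> {x, y}) v)"
    by simp
  then show ?thesis unfolding breaks_def by blast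
qed

lemma breaks_commute: "breaks w x y \<longleftrightarrow> breaks w y x"
  unfolding breaks_def by (simp add: insert_commute)

lemma breaks_not_alternate: "breaks w x y \<Longrightarrow> x \<noteq> y \<Longrightarrow> \<not> alternate w x y"
  unfolding breaks_def alternate_def by (metis alternating_word_no_repeat)

lemma word_respects_alternate: "word_respects D w \<Longrightarrow> D x y \<Longrightarrow> alternate w x y \<and> alternate w y x"
  unfolding word_respects_def alternate_def
  by (metis concat_replicate_alternating insert_commute)

text \<open>The word is \<open>w\<^sub>0\<close>, which supplies all letters, followed by one
  breaking word for each non-adjacent pair.\<close>

lemma word_representable_if_breaks:
  assumes fin: "finite (pverts G)"
    and adj: "\<And>x y. x \<in> pverts G \<Longrightarrow> y \<in> pverts G \<Longrightarrow> x \<noteq> y \<Longrightarrow>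
      (x, y) \<in> parcs G \<longleftrightarrow> D x y \<or> D y x"
    and base: "set w\<^sub>0 = pverts G" "word_respects D w\<^sub>0"
    and break: "\<And>x y. x \<in> pverts G \<Longrightarrow> y \<in> pverts G \<Longrightarrow> x \<noteq> y \<Longrightarrow>
      \<not> D x y \<Longrightarrow> \<not> D y x \<Longrightarrow> \<exists>w. set w \<subseteq> pverts G \<and> word_respects D w \<and> breaks w x y"
  shows "word_representable G"
proof -
  define NE where "NE = {(x, y). x \<in> pverts G \<and> y \<in> pverts G \<and> x \<noteq> y \<and> \<not> D x y \<and> \<not> D y x}"
  have "finite NE"
    by (rule finite_subset[of _ "pverts G \<times> pverts G"]) (auto simp: NE_def fin)
  then obtain ps where ps: "set ps = NE" using finite_list by blast
  have "\<forall>e \<in> NE. \<exists>w. set w \<subseteq> pverts G \<and> word_respects D w \<and> breaks w (fst e) (snd e)"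
    using break by (auto simp: NE_def)
  then obtain W where W: "\<And>e. e \<in> NE \<Longrightarrow> set (W e) \<subseteq> pverts G \<and> word_respects D (W e) \<and>
      breaks (W e) (fst e) (snd e)"
    by metis
  define w where "w = w\<^sub>0 @ concat (map W ps)"
  have "set w = pverts G"
    unfolding w_def using base(1) W ps by auto
  moreover have "alternate w x y \<longleftrightarrow> (x, y) \<in> parcs G"
    if xy: "x \<in> pverts G" "y \<in> pverts G" "x \<noteq> y" for x y
  proof (cases "D x y \<or> D y x")
    case True
    have "word_respects D (concat (map W es))" if "set es \<subseteq> NE" for es
      using that by (induction es) (simp_all add: W word_respects_Nil word_respects_append)
    then have "word_respects D w"
      unfolding w_def using base(2) ps by (simp add: word_respects_append)
    with True xy adj show ?thesis using word_respects_alternate by metis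
  next
    case False
    with xy have "(x, y) \<in> set ps" by (simp add: ps NE_def)
    then obtain es fs where "ps = es @ (x, y) # fs" by (meson split_list)
    then have "w = (w\<^sub>0 @ concat (map W es)) @ W (x, y) @ concat (map W fs)"
      by (simp add: w_def)
    moreover have "breaks (W (x, y)) x y"
      using W[of "(x, y)"] \<open>(x, y) \<in> set ps\<close> ps by simp
    ultimately have "breaks w x y"
      by (simp only: breaks_append)
    with False xy adj show ?thesis using breaks_not_alternate by metis
  qed
  ultimately show ?thesis unfolding word_representable_def by blast
qed

section \<open>Linear extensions of an orientation with sources\<close>

definition linear_extension :: "('a \<Rightarrow> 'a \<Rightarrow> bool) \<Rightarrow> 'a set \<Rightarrow> 'a list \<Rightarrow> bool" where
  "linear_extension D X p \<longleftrightarrow> distinct p \<and> set p = X \<and> sorted_wrt (\<lambda>u v. \<not> D v u) p"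

lemma linear_extension_filter:
  assumes p: "linear_extension D X p" and uv: "u \<in> X" "v \<in> X" "u \<noteq> v" "D u v"
  shows "filter (\<lambda>z. z \<in> {u, v}) p = [u, v]"
proof -
  have "u \<in> set p" using p uv by (simp add: linear_extension_def)
  then obtain p1 p2 where p12: "p = p1 @ u # p2" by (meson split_list)
  then have "v \<in> set p2"
    using p uv by (auto simp: linear_extension_def sorted_wrt_append)
  then obtain p3 p4 where p34: "p2 = p3 @ v # p4" by (meson split_list)
  have "distinct (p1 @ u # p3 @ v # p4)"
    using p by (simp add: linear_extension_def p12 p34)
  then have "filter (\<lambda>z. z \<in> {u, v}) p1 = []" "filter (\<lambda>z. z \<in> {u, v}) p3 = []"
    "filter (\<lambda>z. z \<in> {u, v}) p4 = []"
    by (auto simp: filter_empty_conv)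
  then show ?thesis by (simp add: p12 p34)
qed

text \<open>Arcs never enter the set \<open>S\<close> of sources, so sources can be permuted freely.\<close>

locale source_digraph =
  fixes D :: "'a \<Rightarrow> 'a \<Rightarrow> bool" and S R :: "'a set"
  assumes arc: "D u v \<Longrightarrow> u \<in> S \<union> R \<and> v \<in> R \<and> u \<noteq> v"
    and disj: "S \<inter> R = {}"
    and fin: "finite S"
begin

definition breakable :: "'a \<Rightarrow> 'a \<Rightarrow> bool" where
  "breakable x y \<longleftrightarrow> (\<exists>w. set w \<subseteq> S \<union> R \<and> word_respects D w \<and> breaks w x y)"

lemma breakable_commute: "breakable x y \<longleftrightarrow> breakable y x"
  unfolding breakable_def by (simp add: breaks_commute)

lemma word_respects_linear_extension:
  assumes "linear_extension D (S \<union> R) p" shows "word_respects D p"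
  unfolding word_respects_def
proof (intro allI impI)
  fix u v assume "D u v"
  then have "filter (\<lambda>z. z \<in> {u, v}) p = [u, v]"
    using linear_extension_filter[OF assms, of u v] arc[of u v] by simp
  then show "\<exists>k. filter (\<lambda>z. z \<in> {u, v}) p = concat (replicate k [u, v])"
    by (intro exI[of _ 1]) simp
qed

lemma linear_extension_sources:
  assumes "distinct ss" "set ss = S" "linear_extension D R ls"
  shows "linear_extension D (S \<union> R) (ss @ ls)"
  using assms arc disj unfolding linear_extension_def
  by (auto simp: sorted_wrt_append intro!: sorted_wrt_if_all)

text \<open>Two linear extensions that start with \<open>x, y\<close> and with \<open>y, x\<close>
  and agree otherwise restrict to \<open>x, y, y, x\<close>.\<close>

lemma breakable_sources:
  assumes xy: "x \<in> S" "y \<in> S" "x \<noteq> y" and ls: "linear_extension D R ls"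
  shows "breakable x y"
proof -
  obtain ss where ss: "set ss = S - {x, y}" "distinct ss"
    using finite_distinct_list fin by (metis finite_Diff)
  define w where "w = ([x, y] @ ss @ ls) @ [y, x] @ ss @ ls"
  have "linear_extension D (S \<union> R) (([x, y] @ ss) @ ls)"
    using ss xy by (intro linear_extension_sources ls) auto
  moreover have "linear_extension D (S \<union> R) (([y, x] @ ss) @ ls)"
    using ss xy by (intro linear_extension_sources ls) auto
  ultimately have "word_respects D w"
    unfolding w_def
    using word_respects_append[of D "([x, y] @ ss) @ ls" "([y, x] @ ss) @ ls"]
    by (simp add: word_respects_linear_extension)
  moreover have "filter (\<lambda>z. z \<in> {x, y}) ss = []" "filter (\<lambda>z. z \<in> {x, y}) ls = []"
    using ss ls xy disj by (auto simp: filter_empty_conv linear_extension_def)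
  then have "filter (\<lambda>z. z \<in> {x, y}) w = [x] @ [y, y] @ [x]"
    unfolding w_def filter_append using xy by simp
  then have "breaks w x y" unfolding breaks_def by blast
  moreover have "set w \<subseteq> S \<union> R"
    using ss ls xy by (auto simp: w_def linear_extension_def)
  ultimately show ?thesis unfolding breakable_def by blast
qed

text \<open>Two linear extensions of the non-sources in which \<open>x\<close> and \<open>y\<close>
  come in opposite orders again give \<open>x, y, y, x\<close>.\<close>

lemma breakable_rest:
  assumes xy: "x \<in> R" "y \<in> R"
    and ls: "linear_extension D R ls" "filter (\<lambda>z. z \<in> {x, y}) ls = [x, y]"
    and ms: "linear_extension D R ms" "filter (\<lambda>z. z \<in> {x, y}) ms = [y, x]"
  shows "breakable x y"
proof -
  obtain ss where ss: "set ss = S" "distinct ss"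
    using finite_distinct_list fin by metis
  define w where "w = (ss @ ls) @ ss @ ms"
  have "word_respects D w"
    unfolding w_def using ss ls ms
    by (intro word_respects_append word_respects_linear_extension linear_extension_sources)
  moreover have "filter (\<lambda>z. z \<in> {x, y}) ss = []"
    using ss xy disj by (auto simp: filter_empty_conv)
  then have "filter (\<lambda>z. z \<in> {x, y}) w = [x] @ [y, y] @ [x]"
    unfolding w_def filter_append ls(2) ms(2) by simp
  then have "breaks w x y" unfolding breaks_def by blast
  moreover have "set w \<subseteq> S \<union> R"
    using ss ls ms by (auto simp: w_def linear_extension_def)
  ultimately show ?thesis unfolding breakable_def by blast
qed

text \<open>All arcs from the source \<open>x\<close> end behind \<open>k\<close>, so in a second
  linear extension \<open>x\<close> may stand just behind \<open>k\<close>; the restriction is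
  \<open>x, k, k, x\<close>.\<close>

lemma breakable_after:
  assumes x: "x \<in> S" and ls: "linear_extension D R (pre @ k # post)"
    and out: "\<And>j. D x j \<Longrightarrow> j \<in> set post"
  shows "breakable x k"
proof -
  let ?ls = "pre @ k # post"
  obtain ss where ss: "set ss = S - {x}" "distinct ss"
    using finite_distinct_list fin by (metis finite_Diff)
  define w where "w = (x # ss @ ?ls) @ ss @ pre @ k # x # post"
  have k: "k \<in> R" "set ?ls = R" using ls by (auto simp: linear_extension_def)
  have le: "linear_extension D (S \<union> R) ((x # ss) @ ?ls)"
    using ss x by (intro linear_extension_sources ls) auto
  then have dist: "distinct (x # ss @ ?ls)" by (simp add: linear_extension_def)
  have "\<not> D v x" for v using arc[of v x] x disj by auto
  moreover have "\<not> D x u" if "u \<in> set (ss @ pre @ [k])" for u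
    using out[of u] that dist by auto
  ultimately have "linear_extension D (S \<union> R) (ss @ pre @ k # x # post)"
    using le unfolding linear_extension_def by (simp add: sorted_wrt_append) blast
  with le have "word_respects D w"
    unfolding w_def
    using word_respects_append[of D "(x # ss) @ ?ls" "ss @ pre @ k # x # post"]
    by (simp add: word_respects_linear_extension)
  moreover have "filter (\<lambda>z. z \<in> {x, k}) ss = []" "filter (\<lambda>z. z \<in> {x, k}) pre = []"
    "filter (\<lambda>z. z \<in> {x, k}) post = []" "x \<noteq> k"
    using ss ls x disj k by (auto simp: filter_empty_conv linear_extension_def)
  then have "filter (\<lambda>z. z \<in> {x, k}) w = [x] @ [k, k] @ [x]"
    unfolding w_def by simp
  then have "breaks w x k" unfolding breaks_def by blast
  moreover have "set w \<subseteq> S \<union> R"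
    using ss x k by (auto simp: w_def)
  ultimately show ?thesis unfolding breakable_def by blast
qed

text \<open>In two copies of a linear extension that starts with \<open>x\<close>, the second
  \<open>x\<close> is moved into the first copy, just in front of \<open>k\<close>. It still
  separates the two occurrences of every out-neighbour, since these lie in \<open>pre\<close>, but
  the restriction to \<open>x\<close> and \<open>k\<close> becomes
  \<open>x, x, k, k\<close>.\<close>

lemma breakable_before:
  assumes x: "x \<in> S" and ls: "linear_extension D R (pre @ k # post)"
    and out: "\<And>j. D x j \<Longrightarrow> j \<in> set pre"
  shows "breakable x k"
proof -
  let ?ls = "pre @ k # post"
  obtain ss where ss: "set ss = S - {x}" "distinct ss"
    using finite_distinct_list fin by (metis finite_Diff)
  define w where "w = x # ss @ pre @ x # k # post @ ss @ ?ls"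
  have k: "k \<in> R" "set ?ls = R" using ls by (auto simp: linear_extension_def)
  have dls: "distinct ?ls" using ls by (simp add: linear_extension_def)
  have xR: "x \<notin> R" using x disj by auto
  have le: "linear_extension D (S \<union> R) ((x # ss) @ ?ls)"
    using ss x by (intro linear_extension_sources ls) auto
  have "word_respects D w"
    unfolding word_respects_def
  proof (intro allI impI)
    fix u v assume D: "D u v"
    note a = arc[OF D]
    have "filter (\<lambda>z. z \<in> {u, v}) w = concat (replicate 2 [u, v])"
    proof (cases "u = x")
      case True
      then have v: "v \<in> set pre" "v \<notin> set ss" "v \<noteq> x" "v \<noteq> k" "v \<notin> set post"
        using out D dls a ss disj by auto
      have "filter (\<lambda>z. z \<in> {x, v}) pre = [v]" "filter (\<lambda>z. z \<in> {x, v}) ss = []"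
        "filter (\<lambda>z. z \<in> {x, v}) post = []"
        using v xR k ss dls by (auto simp: filter_pair_distinct filter_empty_conv)
      then show ?thesis
        using True v k xR by (auto simp: w_def numeral_2_eq_2)
    next
      \<comment> \<open>Apart from \<open>x\<close>, the word is twice the same linear
        extension.\<close>
      case False
      moreover have "v \<noteq> x" using a xR by auto
      ultimately have
        "filter (\<lambda>z. z \<in> {u, v}) w = filter (\<lambda>z. z \<in> {u, v}) ((x # ss) @ ?ls)
          @ filter (\<lambda>z. z \<in> {u, v}) ((x # ss) @ ?ls)"
        by (simp add: w_def)
      also have "\<dots> = [u, v] @ [u, v]"
        using linear_extension_filter[OF le _ _ _ D] a by simp
      finally show ?thesis by (simp add: numeral_2_eq_2)
    qed
    then show "\<exists>n. filter (\<lambda>z. z \<in> {u, v}) w = concat (replicate n [u, v])" by blast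
  qed
  moreover have "filter (\<lambda>z. z \<in> {x, k}) ss = []" "filter (\<lambda>z. z \<in> {x, k}) pre = []"
    "filter (\<lambda>z. z \<in> {x, k}) post = []" "x \<noteq> k"
    using ss dls x disj k by (auto simp: filter_empty_conv)
  then have "filter (\<lambda>z. z \<in> {x, k}) w = [] @ [x, x] @ [k, k]"
    unfolding w_def by simp
  then have "breaks w x k" unfolding breaks_def by blast
  moreover have "set w \<subseteq> S \<union> R"
    using ss x k by (auto simp: w_def)
  ultimately show ?thesis unfolding breakable_def by blast
qed

end

section \<open>Split graphs whose neighbourhoods fit a cyclic order\<close>

text \<open>The neighbourhoods left over are the proper intervals of \<open>a, b, c, d\<close>,
  including the empty one, and \<open>{a, d}\<close>. The vertices of the last kind form
  \<open>Z\<close>, the others form the set \<open>S\<close> of sources, and every non-adjacent pair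
  is breakable in the resulting orientation.\<close>

lemma word_representable_if_cyclic_neighbourhoods:
  assumes G: "pair_graph G" and V: "pverts G = {a, b, c, d} \<union> I" "I \<inter> {a, b, c, d} = {}"
    and dist: "distinct [a, b, c, d]"
    and clique: "is_clique G {a, b, c, d}" and indep: "is_independent G I"
    and nb: "\<And>v. v \<in> I \<Longrightarrow> {k \<in> {a, b, c, d}. (v, k) \<in> parcs G} \<notin>
      {{a, b, c, d}, {a, c}, {b, d}, {a, c, d}, {a, b, d}}"
  shows "word_representable G"
proof -
  interpret pair_graph G by (rule G)
  let ?E = "\<lambda>u v. (u, v) \<in> parcs G"
  define Z where "Z = {v \<in> I. ?E v a \<and> ?E v d}"
  define S where "S = I - Z"
  define R where "R = {a, b, c, d} \<union> Z"
  define D where "D u v \<longleftrightarrow> u \<in> S \<and> ?E u v \<or>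
    (u, v) \<in> {(a, b), (a, c), (a, d), (b, c), (b, d), (c, d)} \<or> u = a \<and> v \<in> Z \<or> u \<in> Z \<and> v = d" for u v
  have SR: "S \<union> R = pverts G" "S \<inter> R = {}" "S \<subseteq> I" "Z \<subseteq> I" "I \<subseteq> pverts G"
    using V by (auto simp: S_def R_def Z_def)
  have Esym: "?E u v \<longleftrightarrow> ?E v u" for u v using arcs_symmetric by blast
  have EK: "v \<in> {a, b, c, d}" if "?E u v" "u \<in> I" for u v
    using that indep V(1) in_arcsD2[OF that(1)] unfolding is_independent_def by blast
  have clq: "?E u v" if "u \<in> {a, b, c, d}" "v \<in> {a, b, c, d}" "u \<noteq> v" for u v
    using that clique by (auto simp: is_clique_def)
  have KI: "a \<notin> I" "b \<notin> I" "c \<notin> I" "d \<notin> I" using V by auto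
  have Znb: "?E v k \<longleftrightarrow> k = a \<or> k = d" if "v \<in> Z" for v k
  proof -
    have v: "v \<in> I" "?E v a" "?E v d" using that by (auto simp: Z_def)
    have "{k \<in> {a, b, c, d}. (v, k) \<in> parcs G} = {a, d} \<union> (if ?E v b then {b} else {}) \<union>
      (if ?E v c then {c} else {})" using v by auto
    with nb[OF v(1)] have "\<not> ?E v b" "\<not> ?E v c" by (auto split: if_splits)
    with v show ?thesis using EK by blast
  qed
  \<comment> \<open>Together these say that the neighbourhood is an interval of
    \<open>a, b, c, d\<close> that misses \<open>a\<close> or \<open>d\<close>.\<close>
  have Snb: "\<not> (?E v a \<and> ?E v d)" "?E v a \<Longrightarrow> ?E v c \<Longrightarrow> ?E v b" "?E v b \<Longrightarrow> ?E v d \<Longrightarrow> ?E v c"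
    if "v \<in> S" for v
  proof -
    have v: "v \<in> I" using that SR by auto
    show ad: "\<not> (?E v a \<and> ?E v d)" using that by (auto simp: S_def Z_def)
    have eq: "{k \<in> {a, b, c, d}. (v, k) \<in> parcs G} =
      (if ?E v a then {a} else {}) \<union> (if ?E v b then {b} else {}) \<union>
      (if ?E v c then {c} else {}) \<union> (if ?E v d then {d} else {})" by auto
    show "?E v b" if "?E v a" "?E v c"
      using nb[OF v, unfolded eq] ad that by (auto split: if_splits)
    show "?E v c" if "?E v b" "?E v d"
      using nb[OF v, unfolded eq] ad that by (auto split: if_splits)
  qed
  interpret source_digraph D S R
  proof
    show "u \<in> S \<union> R \<and> v \<in> R \<and> u \<noteq> v" if "D u v" for u v
      using that dist EK SR KI unfolding D_def R_def by fastforce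
    show "S \<inter> R = {}" "finite S" using SR pair_finite_verts by (auto intro: finite_subset)
  qed
  have DS: "D x j \<longleftrightarrow> ?E x j" if "x \<in> S" for x j
    using that SR KI unfolding D_def S_def by auto
  \<comment> \<open>A vertex of \<open>Z\<close> only has to stay between \<open>a\<close> and
    \<open>d\<close>, so the block \<open>zs\<close> may stand on either side of
    \<open>b, c\<close>.\<close>
  have ext: "linear_extension D R (a # zs @ [b, c, d])" "linear_extension D R ([a, b, c] @ zs @ [d])"
    if "distinct zs" "set zs = Z" for zs
    using that dist SR KI unfolding linear_extension_def R_def D_def S_def
    by (auto simp: sorted_wrt_append intro!: sorted_wrt_if_all)
  obtain zs where zs: "set zs = Z" "distinct zs"
    using finite_distinct_list SR pair_finite_verts by (metis finite_subset)
  note e1 = ext(1)[OF zs(2,1)] and e2 = ext(2)[OF zs(2,1)]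
  have SK: "breakable x k" if x: "x \<in> S" and k: "k \<in> {a, b, c, d}" and n: "\<not> ?E x k" for x k
  proof -
    note s = Snb[OF x] and xI = subsetD[OF SR(3) x]
    have out: "j \<in> {a, b, c, d}" "?E x j" if "D x j" for j
      using EK[OF _ xI] DS[OF x] that by blast+
    have A: "breakable x k" if "a # zs @ [b, c, d] = pre @ k # post"
        "\<And>j. j \<in> {a, b, c, d} \<Longrightarrow> ?E x j \<Longrightarrow> j \<in> set post" for pre post
      using breakable_after[OF x, of pre k post] e1 that out by metis
    have B: "breakable x k" if "a # zs @ [b, c, d] = pre @ k # post"
        "\<And>j. j \<in> {a, b, c, d} \<Longrightarrow> ?E x j \<Longrightarrow> j \<in> set pre" for pre post
      using breakable_before[OF x, of pre k post] e1 that out by metis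
    \<comment> \<open>An interval without \<open>k\<close> lies on one side of \<open>k\<close>:
      \<open>A\<close> applies if it lies behind \<open>k\<close>, and \<open>B\<close> if it lies
      in front.\<close>
    consider "k = a" | "k = b" "?E x a" | "k = b" "\<not> ?E x a" | "k = c" "?E x d" | "k = c" "\<not> ?E x d"
      | "k = d" using k by blast
    then show ?thesis
    proof cases
      case 1 then show ?thesis using n by (intro A[of "[]" "zs @ [b, c, d]"]) auto
    next
      case 2 then show ?thesis using n s by (intro B[of "a # zs" "[c, d]"]) auto
    next
      case 3 then show ?thesis using n by (intro A[of "a # zs" "[c, d]"]) auto
    next
      case 4 then show ?thesis using n s by (intro A[of "a # zs @ [b]" "[d]"]) auto
    next
      case 5 then show ?thesis using n by (intro B[of "a # zs @ [b]" "[d]"]) auto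
    next
      case 6 then show ?thesis using n by (intro B[of "a # zs @ [b, c]" "[]"]) auto
    qed
  qed
  have SZ: "breakable x z" if x: "x \<in> S" and z: "z \<in> Z" for x z
  proof -
    note s = Snb[OF x] and xI = subsetD[OF SR(3) x]
    obtain us where us: "set us = Z - {z}" "distinct us"
      using finite_distinct_list zs(1) by (metis finite_Diff List.finite_set)
    have ds: "distinct (z # us)" "set (z # us) = Z" using us z by auto
    have out: "j \<in> {a, b, c, d}" "?E x j" if "D x j" for j
      using EK[OF _ xI] DS[OF x] that by blast+
    \<comment> \<open>A source adjacent to \<open>d\<close> is not adjacent to \<open>a\<close>, so
      all its arcs end behind a \<open>z\<close> placed right after \<open>a\<close>. Otherwise all
      of them end in front of a \<open>z\<close> placed right after \<open>c\<close>.\<close>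
    show ?thesis
    proof (cases "?E x d")
      case True
      then have "j \<in> set (us @ [b, c, d])" if "D x j" for j using out[OF that] s by auto
      then show ?thesis
        using breakable_after[OF x, of "[a]" z "us @ [b, c, d]"] ext(1)[OF ds] by simp
    next
      case False
      then have "j \<in> set [a, b, c]" if "D x j" for j using out[OF that] s by auto
      then show ?thesis
        using breakable_before[OF x, of "[a, b, c]" z "us @ [d]"] ext(2)[OF ds] by simp
    qed
  qed
  have ZZ: "breakable x y" if xy: "x \<in> Z" "y \<in> Z" "x \<noteq> y" for x y
  proof -
    obtain us where us: "set us = Z - {x, y}" "distinct us"
      using finite_distinct_list zs(1) by (metis finite_Diff List.finite_set)
    have "distinct (x # y # us)" "set (x # y # us) = Z" "distinct (y # x # us)" "set (y # x # us) = Z"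
      using us xy by auto
    moreover have "filter (\<lambda>z. z = x \<or> z = y) us = []" using us by (auto simp: filter_empty_conv)
    ultimately show ?thesis
      using xy KI SR by (intro breakable_rest[of _ _ "a # (x # y # us) @ [b, c, d]" "a # (y # x # us) @ [b, c, d]"] ext)
        (auto simp: R_def)
  qed
  \<comment> \<open>In \<open>e1\<close> the vertex \<open>z\<close> stands in front of
    \<open>b\<close> and \<open>c\<close>, in \<open>e2\<close> behind them.\<close>
  have ZK: "breakable z k" if z: "z \<in> Z" and k: "k \<in> {b, c}" for z k
  proof -
    have "z \<notin> {a, b, c, d}" using z KI SR by auto
    moreover have "filter (\<lambda>u. u = z \<or> u = k) zs = [z]"
      using zs z k KI SR by (subst filter_pair_distinct(1)) auto
    ultimately show ?thesis
      using z k dist by (intro breakable_rest[OF _ _ e1 _ e2]) (auto simp: R_def)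
  qed
  have DK: "D u v \<or> D v u" if "u \<in> {a, b, c, d}" "v \<in> {a, b, c, d}" "u \<noteq> v" for u v
    using that unfolding D_def by auto
  obtain ss where ss: "set ss = S" "distinct ss" using finite_distinct_list fin by metis
  show ?thesis
  proof (rule word_representable_if_breaks[of _ D "ss @ a # zs @ [b, c, d]"])
    show "finite (pverts G)" by (rule pair_finite_verts)
    show "set (ss @ a # zs @ [b, c, d]) = pverts G"
      using ss zs SR by (auto simp: R_def)
    show "word_respects D (ss @ a # zs @ [b, c, d])"
      by (intro word_respects_linear_extension linear_extension_sources ss e1)
    show "(x, y) \<in> parcs G \<longleftrightarrow> D x y \<or> D y x"
      if xy: "x \<in> pverts G" "y \<in> pverts G" "x \<noteq> y" for x y
    proof -
      consider "x \<in> S" | "y \<in> S" | "x \<in> Z" "y \<notin> S" | "y \<in> Z" "x \<notin> S"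
        | "x \<in> {a, b, c, d}" "y \<in> {a, b, c, d}"
        using xy SR by (auto simp: R_def)
      then show ?thesis
      proof cases
        case 1 then show ?thesis using DS arc[of y x] SR by auto
      next
        case 2 then show ?thesis using DS arc[of x y] SR Esym[of x y] by auto
      next
        case 3 then show ?thesis using Znb[of x y] xy KI SR dist unfolding D_def S_def by auto
      next
        case 4 then show ?thesis using Znb[of y x] Esym[of x y] xy KI SR dist unfolding D_def S_def by auto
      next
        case 5 then show ?thesis using clq DK xy(3) by blast
      qed
    qed
    show "\<exists>w. set w \<subseteq> pverts G \<and> word_respects D w \<and> breaks w x y"
      if xy: "x \<in> pverts G" "y \<in> pverts G" "x \<noteq> y" and n: "\<not> D x y" "\<not> D y x" for x y
    proof -
      \<comment> \<open>Breaking is symmetric, so \<open>x\<close> may be taken as a source of the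
        pair or, if there is none, as a vertex of \<open>Z\<close>.\<close>
      have half: "breakable x y" if h: "x \<in> S \<or> x \<in> Z \<and> y \<notin> S" "x \<noteq> y" "y \<in> pverts G" "\<not> D x y" "\<not> D y x" for x y
      proof -
        consider "x \<in> S" "y \<in> S" | "x \<in> S" "y \<in> {a, b, c, d}" | "x \<in> S" "y \<in> Z"
          | "x \<in> Z" "y \<in> {a, b, c, d}" | "x \<in> Z" "y \<in> Z"
          using h SR(1) by (auto simp: R_def)
        then show ?thesis
        proof cases
          case 1 then show ?thesis using breakable_sources h e1 by blast
        next
          case 2 then show ?thesis using SK DS h by blast
        next
          case 3 then show ?thesis using SZ by blast
        next
          case 4 
          then have "y \<in> {b, c}" using h by (auto simp: D_def)
          with 4 show ?thesis using ZK by blast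
        next
          case 5 then show ?thesis using ZZ h by blast
        qed
      qed
      have "\<not> (x \<in> {a, b, c, d} \<and> y \<in> {a, b, c, d})"
        using n xy(3) DK by blast
      then consider "x \<in> S \<or> x \<in> Z \<and> y \<notin> S" | "y \<in> S \<or> y \<in> Z \<and> x \<notin> S"
        using xy SR(1) unfolding R_def by blast
      then have "breakable x y"
      proof cases
        case 1 show ?thesis by (rule half[OF 1 xy(3,2) n])
      next
        case 2 show ?thesis using half[OF 2 xy(3)[symmetric] xy(1) n(2,1)] breakable_commute by blast
      qed
      then show ?thesis unfolding breakable_def SR .
    qed
  qed
qed

section \<open>The characterisation\<close>

text \<open>Here \<open>ps\<close> plays the vertices 1 to 4 and \<open>vs\<close> the additional
  ones. Any clique of size 4 may serve as \<open>ps\<close>, so a vertex of the independent side can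
  belong to the clique of a copy.\<close>

lemma contains_induced_K4_extension:
  assumes G: "pair_graph G" and ps: "length ps = 4" "is_clique G (set ps)"
    and vs: "is_independent G (set vs)" and dist: "distinct (ps @ vs)"
    and Ns: "\<Union> (set Ns) \<subseteq> {1..4}"
    and nb: "list_all2 (\<lambda>v N. list_all2 (\<lambda>p i. (v, p) \<in> parcs G \<longleftrightarrow> i \<in> N) ps [1, 2, 3, 4]) vs Ns"
  shows "contains_induced G (K4_extension Ns)"
proof -
  interpret pair_graph G by (rule G)
  note arcs = parcs_K4_extension[OF Ns]
  have len: "length vs = length Ns" using nb by (rule list_all2_lengthD)
  have adj: "(vs ! k, ps ! (i - 1)) \<in> parcs G \<longleftrightarrow> i \<in> Ns ! k" if "k < length Ns" "i \<in> {1..4}" for k i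
  proof -
    have *: "list_all2 (\<lambda>p i. (vs ! k, p) \<in> parcs G \<longleftrightarrow> i \<in> Ns ! k) ps [1, 2, 3, 4]"
      using list_all2_nthD2[OF nb that(1)] .
    have "[1, 2, 3, 4] ! (i - 1) = i"
      using that(2) by (auto simp: numeral_eq_Suc le_Suc_eq)
    moreover have "i - 1 < length [1, 2, 3, 4 :: nat]" using that(2) by auto
    ultimately show ?thesis using list_all2_nthD2[OF *, of "i - 1"] by simp
  qed
  \<comment> \<open>Vertices are numbered from 1 and list positions from 0; as \<open>ps\<close> has
    length 4, the vertex \<open>5 + k\<close> goes to \<open>vs ! k\<close>.\<close>
  define f where "f i = (ps @ vs) ! (i - 1)" for i
  have fp: "f i = ps ! (i - 1)" if "i \<in> {1..4}" for i
    using that ps(1) by (auto simp: f_def nth_append)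
  have fv: "f (5 + k) = vs ! k" for k
    using ps(1) by (simp add: f_def nth_append)
  have inj: "inj_on f (pverts (K4_extension Ns))"
    unfolding pverts_K4_extension
  proof (rule inj_onI)
    fix i j assume ij: "i \<in> {1..4 + length Ns}" "j \<in> {1..4 + length Ns}" "f i = f j"
    then have "i - 1 < length (ps @ vs)" "j - 1 < length (ps @ vs)" using ps(1) len by auto
    then have "i - 1 = j - 1" using nth_eq_iff_index_eq[OF dist] ij(3) by (simp add: f_def)
    then show "i = j" using ij by auto
  qed
  have sub: "f ` pverts (K4_extension Ns) \<subseteq> pverts G"
  proof -
    have "f i \<in> set (ps @ vs)" if "i \<in> {1..4 + length Ns}" for i
      unfolding f_def using that ps(1) len by (intro nth_mem) auto
    moreover have "set (ps @ vs) \<subseteq> pverts G"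
      using ps(2) vs by (simp add: is_clique_def is_independent_def)
    ultimately show ?thesis unfolding pverts_K4_extension by blast
  qed
  have edge: "(i, j) \<in> parcs (K4_extension Ns) \<longleftrightarrow> (f i, f j) \<in> parcs G"
    if ij: "i \<in> {1..4 + length Ns}" "j \<in> {1..4 + length Ns}" for i j
  proof -
    have cases: "i \<in> {1..4} \<or> (\<exists>k<length Ns. i = 5 + k)" if "i \<in> {1..4 + length Ns}" for i
      using that by (cases "i \<le> 4") (auto intro: exI[of _ "i - 5"])
    have mem: "f i \<in> set ps" if "i \<in> {1..4}" for i
      unfolding fp[OF that] using that ps(1) by (intro nth_mem) auto
    consider "i \<in> {1..4}" "j \<in> {1..4}"
      | k where "i \<in> {1..4}" "k < length Ns" "j = 5 + k"
      | k where "j \<in> {1..4}" "k < length Ns" "i = 5 + k"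
      | k l where "k < length Ns" "i = 5 + k" "l < length Ns" "j = 5 + l"
      using cases[OF ij(1)] cases[OF ij(2)] by blast
    then show ?thesis
    proof cases
      case 1
      have "f i = f j \<longleftrightarrow> i = j" using inj ij unfolding pverts_K4_extension by (metis inj_onD)
      then show ?thesis
        using arcs(1)[OF 1] mem[OF 1(1)] mem[OF 1(2)] ps(2) no_loops' unfolding is_clique_def by metis
    next
      case 2
      have "(f i, f j) \<in> parcs G \<longleftrightarrow> (f j, f i) \<in> parcs G" using arcs_symmetric by blast
      then show ?thesis using arcs(2)[OF 2(1,2)] adj[OF 2(2,1)] by (simp only: 2(3) fv fp[OF 2(1)])
    next
      case 3
      then show ?thesis using arcs(3)[OF 3(1,2)] adj[OF 3(2,1)] by (simp only: fv fp[OF 3(1)])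
    next
      case 4
      then show ?thesis using arcs(4)[OF 4(1,3)] vs len by (simp add: fv[simplified] is_independent_def)
    qed
  qed
  show ?thesis
  proof (rule contains_inducedI)
    show "pair_wf_digraph G" by unfold_locales
    show "pair_wf_digraph (K4_extension Ns)" by (rule pair_wf_digraph_K4_extension[OF Ns])
  qed (use inj sub edge in \<open>simp_all add: pverts_K4_extension\<close>)
qed

text \<open>Read \<open>e\<close> as the edges of a graph on \<open>K\<close> and \<open>m\<close>
  as a marking. The excluded patterns are a triangle, a claw, three marked vertices, and a triangle
  or a claw in which one edge is replaced by a marked pair. Hence the edges avoid some perfect
  matching, whose two pairs become opposite.\<close>

lemma ex_cyclic_order:
  fixes e :: "'a \<Rightarrow> 'a \<Rightarrow> bool" and m :: "'a \<Rightarrow> bool"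
  assumes K: "card K = 4"
    and sym: "\<And>x y. e x y \<longleftrightarrow> e y x"
    and ob: "\<And>a b c d. distinct [a, b, c, d] \<Longrightarrow> {a, b, c, d} = K \<Longrightarrow>
      \<not> (e a b \<and> e b c \<and> e a c) \<and> \<not> (e b a \<and> e b c \<and> e b d) \<and> \<not> (m d \<and> m c \<and> m a) \<and>
      \<not> (e a b \<and> e a d \<and> m d \<and> m b) \<and> \<not> (e a b \<and> e a c \<and> m d \<and> m a)"
  obtains a b c d where "distinct [a, b, c, d]" "{a, b, c, d} = K"
    "\<not> e a c" "\<not> e b d" "\<not> m b" "\<not> m c"
proof -
  define Q where "Q a b c d \<longleftrightarrow> distinct [a, b, c, d] \<and> {a, b, c, d} = K" for a b c d
  have swap: "Q b a c d" "Q a c b d" "Q a b d c" if "Q a b c d" for a b c d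
    using that by (auto simp: Q_def insert_commute)
  have ob: "\<not> (e a b \<and> e b c \<and> e a c)" "\<not> (e b a \<and> e b c \<and> e b d)" "\<not> (m d \<and> m c \<and> m a)"
    "\<not> (e a b \<and> e a d \<and> m d \<and> m b)" "\<not> (e a b \<and> e a c \<and> m d \<and> m a)" if "Q a b c d" for a b c d
    using ob that unfolding Q_def by blast+
  note done_if = that
  have fin: thesis if "Q a b c d" "\<not> e a c" "\<not> e b d" "\<not> m b" "\<not> m c" for a b c d
    using that by (intro done_if[of a b c d]) (auto simp: Q_def)
  have ex2: "\<exists>b c. Q a b c d" if "a \<in> K" "d \<in> K" "a \<noteq> d" for a d
  proof -
    have "card (K - {a, d}) = 2" using that K by (simp add: card_Diff_subset)
    then obtain b c where "K - {a, d} = {b, c}" "b \<noteq> c" by (auto simp: card_2_iff)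
    then have "Q a b c d" using that unfolding Q_def by auto
    then show ?thesis by blast
  qed
  show thesis
  proof (cases "\<exists>a d. a \<in> K \<and> d \<in> K \<and> a \<noteq> d \<and> m a \<and> m d")
    case True
    then obtain a b c d where Q: "Q a b c d" and m: "m a" "m d" using ex2 by blast
    have perms: "Q a c b d" "Q b a c d" "Q c a b d" "Q d b c a"
      using Q swap by meson+
    have "\<not> m b" "\<not> m c" using ob(3)[OF Q] ob(3)[OF perms(1)] m by blast+
    \<comment> \<open>The marked vertices \<open>a\<close>, \<open>d\<close> must not be opposite,
      which leaves two matchings. If \<open>e\<close> met both, the two edges would form a triangle
      or a claw with \<open>{a, d}\<close>.\<close>
    moreover have "\<not> e a c \<and> \<not> e b d \<or> \<not> e a b \<and> \<not> e c d"
      using ob(5)[OF Q] ob(5)[OF perms(4)] ob(4)[OF perms(2)] ob(4)[OF perms(3)] m sym by blast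
    ultimately show thesis using fin[OF Q] fin[OF perms(1)] by blast
  next
    case False
    \<comment> \<open>With at most one marked vertex, any cyclic order can be rotated to start
      there; \<open>a\<close> is that vertex, or arbitrary if none is marked.\<close>
    have "\<exists>a \<in> K. \<forall>x \<in> K. m x \<longrightarrow> x = a"
    proof (cases "\<exists>a \<in> K. m a")
      case True then show ?thesis using False by blast
    next
      case nm: False
      have "K \<noteq> {}" using K by auto
      then show ?thesis using nm by blast
    qed
    then obtain a where a: "a \<in> K" "\<And>x. x \<in> K \<Longrightarrow> m x \<Longrightarrow> x = a" by blast
    have "card (K - {a}) = 3" using K a(1) by simp
    then obtain d where "d \<in> K" "a \<noteq> d" by (metis DiffE card.empty ex_in_conv singletonI zero_neq_numeral)
    then obtain b c where Q: "Q a b c d" using ex2 a(1) by blast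
    then have m: "\<not> m b" "\<not> m c" "\<not> m d" using a(2) unfolding Q_def by auto
    have perms: "Q a c d b" "Q a b d c" "Q b c d a" "Q b a c d" "Q a c b d" "Q a d b c"
      using Q swap by meson+
    \<comment> \<open>Three edges, one from each perfect matching, form a triangle or a claw.\<close>
    have "\<not> e a c \<and> \<not> e b d \<or> \<not> e a b \<and> \<not> e c d \<or> \<not> e a d \<and> \<not> e b c"
      using ob(1)[OF Q] ob(1)[OF perms(1)] ob(1)[OF perms(2)] ob(1)[OF perms(3)]
        ob(2)[OF Q] ob(2)[OF perms(4)] ob(2)[OF perms(5)] ob(2)[OF perms(6)] sym by meson
    then show thesis using fin[OF Q] fin[OF perms(5)] fin[OF perms(2)] m by blast
  qed
qed

theorem theorem14:
  fixes G :: "'a pair_pre_digraph" and n :: nat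
  assumes "split_graph n 4 G"
  shows "word_representable G \<longleftrightarrow>
    \<not> contains_induced G T1 \<and> \<not> contains_induced G T2 \<and>
    \<not> contains_induced G T3 \<and> \<not> contains_induced G T4"
proof
  assume "word_representable G"
  then show "\<not> contains_induced G T1 \<and> \<not> contains_induced G T2 \<and>
      \<not> contains_induced G T3 \<and> \<not> contains_induced G T4"
    using word_representable_induced not_word_representable_T by blast
next
  assume free: "\<not> contains_induced G T1 \<and> \<not> contains_induced G T2 \<and>
    \<not> contains_induced G T3 \<and> \<not> contains_induced G T4"
  obtain I K where G: "pair_graph G" and V: "pverts G = I \<union> K" "I \<inter> K = {}" and K: "card K = 4"
    and clique: "is_clique G K" and indep: "is_independent G I"
    and deg: "\<And>v. v \<in> I \<Longrightarrow> out_degree (with_proj G) v < 4"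
    using assms unfolding split_graph_def by blast
  interpret pair_graph G by (rule G)
  define nb where "nb v = {k \<in> K. (v, k) \<in> parcs G}" for v
  define P where "P X \<longleftrightarrow> (\<exists>v \<in> I. nb v = X)" for X
  have nbD: "(v, k) \<in> parcs G \<longleftrightarrow> k \<in> nb v" if "k \<in> K" for v k
    using that by (simp add: nb_def)
  have ind: "(u, v) \<notin> parcs G" if "u \<in> I" "v \<in> I" for u v
    using that indep by (simp add: is_independent_def)
  have T: "contains_induced G (K4_extension Ns)"
    if "distinct ps" "set ps \<subseteq> K" "length ps = 4" "distinct vs" "set vs \<subseteq> I" "\<Union> (set Ns) \<subseteq> {1..4}"
      "list_all2 (\<lambda>v N. list_all2 (\<lambda>p i. p \<in> nb v \<longleftrightarrow> i \<in> N) ps [1, 2, 3, 4]) vs Ns" for ps vs Ns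
  proof (rule contains_induced_K4_extension[OF G that(3)])
    show "is_clique G (set ps)" using that(2) clique unfolding is_clique_def by blast
    show "is_independent G (set vs)" using that(5) indep unfolding is_independent_def by blast
    show "distinct (ps @ vs)" using that V(2) by auto
    have "list_all2 (\<lambda>p i. (v, p) \<in> parcs G \<longleftrightarrow> i \<in> N) ps js =
        list_all2 (\<lambda>p i. p \<in> nb v \<longleftrightarrow> i \<in> N) ps js" for v js and N :: "nat set"
      by (rule list.rel_cong) (use that(2) nbD in \<open>auto\<close>)
    then show "list_all2 (\<lambda>v N. list_all2 (\<lambda>p i. (v, p) \<in> parcs G \<longleftrightarrow> i \<in> N) ps [1, 2, 3, 4]) vs Ns"
      using that(7) by (simp only:)
  qed fact
  \<comment> \<open>The edges are the pairs that occur as neighbourhoods, and a vertex is marked if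
    a triple that occurs misses it. The excluded patterns yield \<open>T1\<close>,
    \<open>T2\<close>, \<open>T3\<close>, \<open>T4\<close> and, for the last one, \<open>T1\<close>
    again.\<close>
  obtain a b c d where dist: "distinct [a, b, c, d]" and abcd: "{a, b, c, d} = K"
    and no: "\<not> P {a, c}" "\<not> P {b, d}" "\<not> P (K - {b})" "\<not> P (K - {c})"
  proof (rule ex_cyclic_order[of K "\<lambda>x y. P {x, y}" "\<lambda>x. P (K - {x})"])
    show "card K = 4" by (rule K)
    show "P {x, y} \<longleftrightarrow> P {y, x}" for x y by (simp add: insert_commute)
    fix a b c d assume dist: "distinct [a, b, c, d]" and abcd: "{a, b, c, d} = K"
    have minus: "K - {a} = {b, c, d}" "K - {b} = {a, c, d}" "K - {c} = {a, b, d}" "K - {d} = {a, b, c}"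
      using dist abcd by auto
    have ps: "set [a, b, c, d] \<subseteq> K" "length [a, b, c, d] = 4" using abcd by auto
    have 1: False if "P {a, b}" "P {b, c}" "P {a, c}"
    proof -
      obtain u v w where "u \<in> I" "v \<in> I" "w \<in> I" "nb u = {a, b}" "nb v = {b, c}" "nb w = {a, c}"
        using \<open>P {a, b}\<close> \<open>P {b, c}\<close> \<open>P {a, c}\<close> unfolding P_def by blast
      moreover from this have "distinct [u, v, w]" using dist by (auto simp: doubleton_eq_iff)
      ultimately have "contains_induced G T1"
        unfolding T1_def using dist by (intro T[OF dist ps, of "[u, v, w]"]) auto
      then show False using free by blast
    qed
    have 2: False if "P {b, a}" "P {b, c}" "P {b, d}"
    proof -
      obtain u v w where "u \<in> I" "v \<in> I" "w \<in> I" "nb u = {b, a}" "nb v = {b, c}" "nb w = {b, d}"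
        using \<open>P {b, a}\<close> \<open>P {b, c}\<close> \<open>P {b, d}\<close> unfolding P_def by blast
      moreover from this have "distinct [u, v, w]" using dist by (auto simp: doubleton_eq_iff)
      ultimately have "contains_induced G T2"
        unfolding T2_def using dist by (intro T[OF dist ps, of "[u, v, w]"]) auto
      then show False using free by blast
    qed
    have 3: False if "P {a, b, c}" "P {a, b, d}" "P {b, c, d}"
    proof -
      obtain u v w where uvw: "u \<in> I" "v \<in> I" "w \<in> I"
        and nb: "nb u = {a, b, c}" "nb v = {a, b, d}" "nb w = {b, c, d}"
        using \<open>P {a, b, c}\<close> \<open>P {a, b, d}\<close> \<open>P {b, c, d}\<close> unfolding P_def by blast
      have "c \<in> nb u \<and> c \<notin> nb v \<and> a \<in> nb u \<and> a \<in> nb v \<and> a \<notin> nb w" unfolding nb using dist by auto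
      then have "distinct [u, v, w]" by auto
      with uvw nb have "contains_induced G T3"
        unfolding T3_def using dist by (intro T[OF dist ps, of "[u, v, w]"]) auto
      then show False using free by blast
    qed
    have 4: False if "P {a, b}" "P {a, d}" "P {a, b, c}" "P {a, c, d}"
    proof -
      obtain u v w x where uvw: "u \<in> I" "v \<in> I" "w \<in> I" "x \<in> I"
        and nb: "nb u = {a, b}" "nb v = {a, d}" "nb w = {a, b, c}" "nb x = {a, c, d}"
        using \<open>P {a, b}\<close> \<open>P {a, d}\<close> \<open>P {a, b, c}\<close> \<open>P {a, c, d}\<close> unfolding P_def by blast
      \<comment> \<open>Membership of \<open>b\<close> and \<open>c\<close> already separates the
        four vertices.\<close>
      have "b \<in> nb u \<and> c \<notin> nb u \<and> b \<notin> nb v \<and> c \<notin> nb v \<and> b \<in> nb w \<and> c \<in> nb w \<and> b \<notin> nb x \<and> c \<in> nb x"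
        unfolding nb using dist by auto
      then have "distinct [u, v, w, x]" by auto
      with uvw nb have "contains_induced G T4"
        unfolding T4_def using dist by (intro T[OF dist ps, of "[u, v, w, x]"]) auto
      then show False using free by blast
    qed
    \<comment> \<open>A vertex with neighbourhood \<open>{a, b, c}\<close> takes the place of \<open>d\<close> in the clique of a copy of \<open>T1\<close>.\<close>
    have 5: False if "P {a, b}" "P {a, c}" "P {a, b, c}" "P {b, c, d}"
    proof -
      obtain u v w x where uvw: "u \<in> I" "v \<in> I" "w \<in> I" "x \<in> I"
        and nb: "nb u = {a, b}" "nb v = {a, c}" "nb w = {a, b, c}" "nb x = {b, c, d}"
        using \<open>P {a, b}\<close> \<open>P {a, c}\<close> \<open>P {a, b, c}\<close> \<open>P {b, c, d}\<close> unfolding P_def by blast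
      have "b \<in> nb u \<and> c \<notin> nb u \<and> b \<notin> nb v \<and> b \<in> nb w \<and> c \<in> nb w \<and> a \<in> nb w \<and> b \<in> nb x \<and> c \<in> nb x \<and> a \<notin> nb x"
        unfolding nb using dist by auto
      then have d4: "distinct [u, v, w, x]" by auto
      have inK: "a \<in> K" "b \<in> K" "c \<in> K" using abcd by auto
      then have notI: "a \<notin> I" "b \<notin> I" "c \<notin> I" using V(2) by auto
      have "(w, k) \<in> parcs G \<and> (k, w) \<in> parcs G" if "k \<in> {a, b, c}" for k
        using that nb(3) arcs_symmetric[of w k] by (auto simp: nb_def)
      then have "is_clique G (set [a, b, c, w])"
        using clique inK uvw(3) V(1) dist unfolding is_clique_def by auto
      moreover have "is_independent G (set [u, x, v])"
        using uvw V(1) ind unfolding is_independent_def by auto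
      \<comment> \<open>With \<open>w\<close> in place of \<open>d\<close>, the vertex
        \<open>x\<close> contributes only \<open>{b, c}\<close>, since it is not adjacent to
        \<open>w\<close>.\<close>
      moreover have "list_all2 (\<lambda>v N. list_all2 (\<lambda>p i. (v, p) \<in> parcs G \<longleftrightarrow> i \<in> N) [a, b, c, w] [1, 2, 3, 4])
        [u, x, v] [{1, 2}, {2, 3}, {1, 3 :: nat}]"
        using dist by (simp add: nbD inK nb ind uvw) auto
      moreover have "distinct ([a, b, c, w] @ [u, x, v])" using dist d4 notI uvw by auto
      ultimately have "contains_induced G T1"
        unfolding T1_def by (intro contains_induced_K4_extension[OF G, of "[a, b, c, w]" "[u, x, v]"]) auto
      then show False using free by blast
    qed
    show "\<not> (P {a, b} \<and> P {b, c} \<and> P {a, c}) \<and> \<not> (P {b, a} \<and> P {b, c} \<and> P {b, d}) \<and>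
      \<not> (P (K - {d}) \<and> P (K - {c}) \<and> P (K - {a})) \<and>
      \<not> (P {a, b} \<and> P {a, d} \<and> P (K - {d}) \<and> P (K - {b})) \<and>
      \<not> (P {a, b} \<and> P {a, c} \<and> P (K - {d}) \<and> P (K - {a}))"
      unfolding minus using 1 2 3 4 5 by blast
  qed (rule that)
  show "word_representable G"
  proof (rule word_representable_if_cyclic_neighbourhoods[OF G _ _ dist])
    show "pverts G = {a, b, c, d} \<union> I" "I \<inter> {a, b, c, d} = {}"
      "is_clique G {a, b, c, d}" "is_independent G I"
      using V clique indep unfolding abcd by auto
    fix v assume v: "v \<in> I"
    \<comment> \<open>Maximality of the clique enters here: adjacency to all four vertices would
      violate the degree bound.\<close>
    have "nb v \<noteq> K"
    proof
      assume full: "nb v = K"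
      have "Pair v ` K \<subseteq> out_arcs (with_proj G) v"
        using full by (auto simp: nb_def)
      then have "card (Pair v ` K) \<le> out_degree (with_proj G) v"
        unfolding out_degree_def by (intro card_mono finite_out_arcs)
      then show False using deg[OF v] K by (simp add: card_image inj_on_def)
    qed
    moreover have "nb v \<notin> {{a, c}, {b, d}, K - {b}, K - {c}}"
      using no v unfolding P_def by blast
    moreover have "K - {b} = {a, c, d}" "K - {c} = {a, b, d}" using dist abcd by auto
    ultimately show "{k \<in> {a, b, c, d}. (v, k) \<in> parcs G} \<notin>
        {{a, b, c, d}, {a, c}, {b, d}, {a, c, d}, {a, b, d}}"
      unfolding abcd nb_def by auto
  qed
qed

end
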